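(* Let $(M,\varphi,\xi,\eta,g)$ be an almost contact B-metric manifold. The Schouten-van Kampen connection $\nabla^\circ$ is a natural connection for the structure $(\varphi,\xi,\eta,g)$ if and only if $(M,\varphi,\xi,\eta,g)$ belongs to the class $\mathcal U_2=\mathcal F_4\oplus\mathcal F_5\oplus\mathcal F_6\oplus\mathcal F_7\oplus\mathcal F_8\oplus\mathcal F_9\oplus\mathcal F_{11}$. In this case $\nabla^\circ$ coincides with the $\varphi$B-connection.
   Context: An almost contact B-metric manifold $(M,\varphi,\xi,\eta,g)$ is a $(2n+1)$-dimensional manifold with an endomorphism $\varphi$ of $TM$, a vector field $\xi$, a 1-form $\eta$ and a pseudo-Riemannian metric $g$ of signature $(n+1,n)$ with $\varphi\xi=0$, $\varphi^2=-I+\eta\otimes\xi$, $\eta\circ\varphi=0$, $\eta(\xi)=1$, $g(\varphi x,\varphi y)=-g(x,y)+\eta(x)\eta(y)$. Let $\nabla$ be its Levi-Civita connection, $F(x,y,z)=g((\nabla_x\varphi)y,z)$, $\theta(z)=g^{ij}F(e_i,e_j,z)$, $\theta^*(z)=g^{ij}F(e_i,\varphi e_j,z)$, $\omega(z)=F(\xi,\xi,z)$. For a vector $x$ put $x^{\mathrm h}=x-\eta(x)\xi$, $x^{\mathrm v}=\eta(x)\xi$. The Schouten-van Kampen connection associated to $\nabla$ and adapted to the pair $(\ker\eta,\mathrm{span}(\xi))$ is $\nabla^\circ_xy=(\nabla_xy^{\mathrm h})^{\mathrm h}+(\nabla_xy^{\mathrm v})^{\mathrm v}$. An affine connection is natural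 for $(\varphi,\xi,\eta,g)$ if $\varphi,\xi,\eta,g$ are parallel with respect to it. The $\varphi$B-connection is $\nabla'_xy=\nabla_xy+\frac12\{(\nabla_x\varphi)\varphi y+(\nabla_x\eta)(y)\,\xi\}-\eta(y)\nabla_x\xi$. Basic classes: $\mathcal F_4$: $F(x,y,z)=-\frac{\theta(\xi)}{2n}\{g(\varphi x,\varphi y)\eta(z)+g(\varphi x,\varphi z)\eta(y)\}$; $\mathcal F_5$: $F(x,y,z)=-\frac{\theta^*(\xi)}{2n}\{g(x,\varphi y)\eta(z)+g(x,\varphi z)\eta(y)\}$; for $\mathcal F_6,\dots,\mathcal F_9$: $F(x,y,z)=F(x,y,\xi)\eta(z)+F(x,z,\xi)\eta(y)$ together with $\mathcal F_6$: $F(x,y,\xi)=F(y,x,\xi)=-F(\varphi x,\varphi y,\xi)$, $\theta=\theta^*=0$; $\mathcal F_7$: $F(x,y,\xi)=-F(y,x,\xi)=-F(\varphi x,\varphi y,\xi)$; $\mathcal F_8$: $F(x,y,\xi)=F(y,x,\xi)=F(\varphi x,\varphi y,\xi)$; $\mathcal F_9$: $F(x,y,\xi)=-F(y,x,\xi)=F(\varphi x,\varphi y,\xi)$; $\mathcal F_{11}$: $F(x,y,z)=\eta(x)\{\eta(y)\omega(z)+\eta(z)\omega(y)\}$. The manifold belongs to a direct sum of classes if $F$ is a sum of tensors having the algebraic properties of $F$ ($F(x,y,z)=F(x,z,y)=F(x,\varphi y,\varphi z)+\eta(y)F(x,\xi,z)+\eta(z)F(x,y,\xi)$) and satisfying the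 respective class conditions. *)

theory Defs
  imports "HOL-Analysis.Analysis"
begin

section \<open>Smooth manifolds\<close>

primrec C_k_on :: "nat \<Rightarrow> 'b set \<Rightarrow> ('b::real_normed_vector \<Rightarrow> 'c::real_normed_vector) \<Rightarrow> bool" where
  "C_k_on 0 S f \<longleftrightarrow> continuous_on S f"
| "C_k_on (Suc k) S f \<longleftrightarrow> (\<forall>x\<in>S. f differentiable (at x)) \<and>
     (\<forall>v. C_k_on k S (\<lambda>x. frechet_derivative f (at x) v))"

text \<open>Only used for open \<^term>\<open>S\<close> in a Euclidean space.\<close>

definition smooth_on :: "'b set \<Rightarrow> ('b::real_normed_vector \<Rightarrow> 'c::real_normed_vector) \<Rightarrow> bool" where
  "smooth_on S f \<longleftrightarrow> (\<forall>k. C_k_on k S f)"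

text \<open>The manifold is the whole (Hausdorff, second countable) type \<^typ>\<open>'a\<close>. A chart is a pair
  of an open set and a coordinate map, which is constrained on that set only.\<close>

type_synonym ('a, 'e) atlas = "('a set \<times> ('a \<Rightarrow> 'e)) set"

definition smooth_manifold ::
    "('a::{t2_space,second_countable_topology}, 'e::euclidean_space) atlas \<Rightarrow> bool" where
  "smooth_manifold A \<longleftrightarrow>
     (\<forall>(U, c)\<in>A. open U \<and> open (c ` U) \<and> homeomorphism U (c ` U) c (inv_into U c)) \<and>
     (\<Union>(U, c)\<in>A. U) = UNIV \<and>
     (\<forall>(U, c)\<in>A. \<forall>(V, d)\<in>A. smooth_on (c ` (U \<inter> V)) (d \<circ> inv_into U c))"

text \<open>Smoothness of a real function on some neighbourhood of \<^term>\<open>p\<close>; the values outside of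
  that neighbourhood are irrelevant.\<close>

definition smooth_near :: "('a::{t2_space,second_countable_topology}, 'e::euclidean_space) atlas \<Rightarrow>
    'a \<Rightarrow> ('a \<Rightarrow> real) \<Rightarrow> bool" where
  "smooth_near A p f \<longleftrightarrow> (\<exists>W. open W \<and> p \<in> W \<and>
     (\<forall>(U, c)\<in>A. smooth_on (c ` (U \<inter> W)) (f \<circ> inv_into U c)))"


section \<open>Tangent vectors and vector fields\<close>

text \<open>Tangent vectors are derivations at a point. They live in the real vector space of all
  functionals on functions \<^typ>\<open>'a \<Rightarrow> real\<close>, wrapped into a type so as to be an instance of the
  class \<^class>\<open>real_vector\<close>.\<close>

typedef 'a functional = "UNIV :: (('a \<Rightarrow> real) \<Rightarrow> real) set"
  morphisms act Functional
  by simp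

lemma act_Functional [simp]: "act (Functional v) = v"
  by (simp add: Functional_inverse)

lemma functional_eqI: "(\<And>f. act v f = act w f) \<Longrightarrow> v = w"
  by (metis act_inject ext)

instantiation functional :: (type) real_vector
begin

definition "0 = Functional (\<lambda>f. 0)"
definition "v + w = Functional (\<lambda>f. act v f + act w f)"
definition "- v = Functional (\<lambda>f. - act v f)"
definition "v - w = Functional (\<lambda>f. act v f - act w f)"
definition "a *\<^sub>R v = Functional (\<lambda>f. a * act v f)"

lemma act_simps [simp]:
  "act 0 f = 0" "act (v + w) f = act v f + act w f" "act (- v) f = - act v f"
  "act (v - w) f = act v f - act w f" "act (a *\<^sub>R v) f = a * act v f"
  by (simp_all add: zero_functional_def plus_functional_def uminus_functional_def
      minus_functional_def scaleR_functional_def)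

instance
  by standard (auto intro!: functional_eqI simp: algebra_simps)

end

text \<open>A derivation at \<^term>\<open>p\<close> is defined on the functions smooth near \<^term>\<open>p\<close>; setting it to
  zero on all other functions makes its representation unique. It depends only on germs: if
  \<^term>\<open>f\<close> vanishes near \<^term>\<open>p\<close>, apply the product rule to \<^term>\<open>f\<close> times the indicator function
  of the complement of a neighbourhood, which is smooth near \<^term>\<open>p\<close>.\<close>

definition tangent_space :: "('a::{t2_space,second_countable_topology}, 'e::euclidean_space) atlas \<Rightarrow>
    'a \<Rightarrow> 'a functional set" where
  "tangent_space A p = {v.
     (\<forall>f g. smooth_near A p f \<longrightarrow> smooth_near A p g \<longrightarrow>
        act v (\<lambda>q. f q + g q) = act v f + act v g \<and>
        act v (\<lambda>q. f q * g q) = act v f * g p + f p * act v g) \<and>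
     (\<forall>a f. smooth_near A p f \<longrightarrow> act v (\<lambda>q. a * f q) = a * act v f) \<and>
     (\<forall>f. \<not> smooth_near A p f \<longrightarrow> act v f = 0)}"

text \<open>\<^term>\<open>X\<close> is a smooth vector field on some neighbourhood of \<^term>\<open>p\<close>. (Applying the second
  clause to coordinate functions shows that the components of \<^term>\<open>X\<close> are smooth on a common
  neighbourhood.)\<close>

definition vector_field_near :: "('a::{t2_space,second_countable_topology}, 'e::euclidean_space) atlas \<Rightarrow>
    'a \<Rightarrow> ('a \<Rightarrow> 'a functional) \<Rightarrow> bool" where
  "vector_field_near A p X \<longleftrightarrow>
     (\<forall>\<^sub>F q in nhds p. X q \<in> tangent_space A q) \<and>
     (\<forall>f. smooth_near A p f \<longrightarrow> smooth_near A p (\<lambda>q. act (X q) f))"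

definition vector_field :: "('a::{t2_space,second_countable_topology}, 'e::euclidean_space) atlas \<Rightarrow>
    ('a \<Rightarrow> 'a functional) \<Rightarrow> bool" where
  "vector_field A X \<longleftrightarrow> (\<forall>p. vector_field_near A p X)"

definition lie_bracket :: "('a::{t2_space,second_countable_topology}, 'e::euclidean_space) atlas \<Rightarrow>
    ('a \<Rightarrow> 'a functional) \<Rightarrow> ('a \<Rightarrow> 'a functional) \<Rightarrow> 'a \<Rightarrow> 'a functional" where
  "lie_bracket A X Y p = Functional (\<lambda>f. if smooth_near A p f
     then act (X p) (\<lambda>q. act (Y q) f) - act (Y p) (\<lambda>q. act (X q) f) else 0)"


section \<open>Tensor fields\<close>

definition linear_map_on :: "'v::real_vector set \<Rightarrow> ('v \<Rightarrow> 'w::real_vector) \<Rightarrow> bool" where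
  "linear_map_on V L \<longleftrightarrow>
     (\<forall>x\<in>V. \<forall>y\<in>V. \<forall>a b. L (a *\<^sub>R x + b *\<^sub>R y) = a *\<^sub>R L x + b *\<^sub>R L y)"

definition endo_field :: "('a::{t2_space,second_countable_topology}, 'e::euclidean_space) atlas \<Rightarrow>
    ('a \<Rightarrow> 'a functional \<Rightarrow> 'a functional) \<Rightarrow> bool" where
  "endo_field A \<phi> \<longleftrightarrow>
     (\<forall>p. linear_map_on (tangent_space A p) (\<phi> p) \<and>
          \<phi> p ` tangent_space A p \<subseteq> tangent_space A p) \<and>
     (\<forall>p X. vector_field_near A p X \<longrightarrow> vector_field_near A p (\<lambda>q. \<phi> q (X q)))"

definition one_form :: "('a::{t2_space,second_countable_topology}, 'e::euclidean_space) atlas \<Rightarrow>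
    ('a \<Rightarrow> 'a functional \<Rightarrow> real) \<Rightarrow> bool" where
  "one_form A \<eta> \<longleftrightarrow>
     (\<forall>p. linear_map_on (tangent_space A p) (\<eta> p)) \<and>
     (\<forall>p X. vector_field_near A p X \<longrightarrow> smooth_near A p (\<lambda>q. \<eta> q (X q)))"

definition basis_seq :: "'v::real_vector set \<Rightarrow> nat \<Rightarrow> (nat \<Rightarrow> 'v) \<Rightarrow> bool" where
  "basis_seq V m e \<longleftrightarrow>
     inj_on e {..<m} \<and> independent (e ` {..<m}) \<and> span (e ` {..<m}) = V"

definition pseudo_riemannian_metric ::
    "('a::{t2_space,second_countable_topology}, 'e::euclidean_space) atlas \<Rightarrow> nat \<Rightarrow> nat \<Rightarrow>
     ('a \<Rightarrow> 'a functional \<Rightarrow> 'a functional \<Rightarrow> real) \<Rightarrow> bool" where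
  "pseudo_riemannian_metric A r s g \<longleftrightarrow>
     (\<forall>p. \<forall>x\<in>tangent_space A p. linear_map_on (tangent_space A p) (g p x)) \<and>
     (\<forall>p. \<forall>x\<in>tangent_space A p. \<forall>y\<in>tangent_space A p. g p x y = g p y x) \<and>
     (\<forall>p X Y. vector_field_near A p X \<longrightarrow> vector_field_near A p Y \<longrightarrow>
        smooth_near A p (\<lambda>q. g q (X q) (Y q))) \<and>
     (\<forall>p. \<exists>e. basis_seq (tangent_space A p) (r + s) e \<and>
        (\<forall>i<r+s. \<forall>j<r+s. g p (e i) (e j) = (if i \<noteq> j then 0 else if i < r then 1 else - 1)))"


section \<open>Affine connections\<close>

text \<open>\<^term>\<open>D p x Y\<close> is the covariant derivative of \<^term>\<open>Y\<close>, a vector field smooth near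
  \<^term>\<open>p\<close>, in the direction of the tangent vector \<^term>\<open>x\<close> at \<^term>\<open>p\<close>. Since covariant derivatives are
  local, this is the same as a connection on globally defined vector fields. As for tangent
  vectors, the product rule makes \<^term>\<open>D p x Y\<close> depend only on the germ of \<^term>\<open>Y\<close> at \<^term>\<open>p\<close>.\<close>

type_synonym 'a connection = "'a \<Rightarrow> 'a functional \<Rightarrow> ('a \<Rightarrow> 'a functional) \<Rightarrow> 'a functional"

definition affine_connection ::
    "('a::{t2_space,second_countable_topology}, 'e::euclidean_space) atlas \<Rightarrow>
     'a connection \<Rightarrow> bool" where
  "affine_connection A D \<longleftrightarrow>
     (\<forall>p Y. vector_field_near A p Y \<longrightarrow>
        linear_map_on (tangent_space A p) (\<lambda>x. D p x Y) \<and>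
        (\<forall>x\<in>tangent_space A p. D p x Y \<in> tangent_space A p)) \<and>
     (\<forall>p Y Z. \<forall>x\<in>tangent_space A p. vector_field_near A p Y \<longrightarrow> vector_field_near A p Z \<longrightarrow>
        D p x (\<lambda>q. Y q + Z q) = D p x Y + D p x Z) \<and>
     (\<forall>p f Y. \<forall>x\<in>tangent_space A p. smooth_near A p f \<longrightarrow> vector_field_near A p Y \<longrightarrow>
        D p x (\<lambda>q. f q *\<^sub>R Y q) = act x f *\<^sub>R Y p + f p *\<^sub>R D p x Y) \<and>
     (\<forall>p X Y. vector_field_near A p X \<longrightarrow> vector_field_near A p Y \<longrightarrow>
        vector_field_near A p (\<lambda>q. D q (X q) Y))"

definition cov_endo :: "'a connection \<Rightarrow> ('a \<Rightarrow> 'a functional \<Rightarrow> 'a functional) \<Rightarrow> 'a connection" where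
  "cov_endo D \<phi> p x Y = D p x (\<lambda>q. \<phi> q (Y q)) - \<phi> p (D p x Y)"

definition cov_form :: "'a connection \<Rightarrow> ('a \<Rightarrow> 'a functional \<Rightarrow> real) \<Rightarrow>
    'a \<Rightarrow> 'a functional \<Rightarrow> ('a \<Rightarrow> 'a functional) \<Rightarrow> real" where
  "cov_form D \<eta> p x Y = act x (\<lambda>q. \<eta> q (Y q)) - \<eta> p (D p x Y)"

definition cov_metric :: "'a connection \<Rightarrow> ('a \<Rightarrow> 'a functional \<Rightarrow> 'a functional \<Rightarrow> real) \<Rightarrow>
    'a \<Rightarrow> 'a functional \<Rightarrow> ('a \<Rightarrow> 'a functional) \<Rightarrow> ('a \<Rightarrow> 'a functional) \<Rightarrow> real" where
  "cov_metric D g p x Y Z =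
     act x (\<lambda>q. g q (Y q) (Z q)) - g p (D p x Y) (Z p) - g p (Y p) (D p x Z)"

definition metric_parallel ::
    "('a::{t2_space,second_countable_topology}, 'e::euclidean_space) atlas \<Rightarrow>
     ('a \<Rightarrow> 'a functional \<Rightarrow> 'a functional \<Rightarrow> real) \<Rightarrow> 'a connection \<Rightarrow> bool" where
  "metric_parallel A g D \<longleftrightarrow>
     (\<forall>p Y Z. \<forall>x\<in>tangent_space A p. vector_field_near A p Y \<longrightarrow> vector_field_near A p Z \<longrightarrow>
        cov_metric D g p x Y Z = 0)"

definition torsion_free ::
    "('a::{t2_space,second_countable_topology}, 'e::euclidean_space) atlas \<Rightarrow>
     'a connection \<Rightarrow> bool" where
  "torsion_free A D \<longleftrightarrow>
     (\<forall>p X Y. vector_field_near A p X \<longrightarrow> vector_field_near A p Y \<longrightarrow>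
        D p (X p) Y - D p (Y p) X = lie_bracket A X Y p)"

definition levi_civita ::
    "('a::{t2_space,second_countable_topology}, 'e::euclidean_space) atlas \<Rightarrow>
     ('a \<Rightarrow> 'a functional \<Rightarrow> 'a functional \<Rightarrow> real) \<Rightarrow> 'a connection \<Rightarrow> bool" where
  "levi_civita A g D \<longleftrightarrow> affine_connection A D \<and> metric_parallel A g D \<and> torsion_free A D"


section \<open>Almost contact B-metric manifolds\<close>

definition almost_contact_B_metric_manifold ::
    "('a::{t2_space,second_countable_topology}, 'e::euclidean_space) atlas \<Rightarrow> nat \<Rightarrow>
     ('a \<Rightarrow> 'a functional \<Rightarrow> 'a functional) \<Rightarrow> ('a \<Rightarrow> 'a functional) \<Rightarrow>
     ('a \<Rightarrow> 'a functional \<Rightarrow> real) \<Rightarrow> ('a \<Rightarrow> 'a functional \<Rightarrow> 'a functional \<Rightarrow> real) \<Rightarrow> bool" where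
  "almost_contact_B_metric_manifold A n \<phi> \<xi> \<eta> g \<longleftrightarrow>
     smooth_manifold A \<and> DIM('e) = 2 * n + 1 \<and>
     endo_field A \<phi> \<and> vector_field A \<xi> \<and> one_form A \<eta> \<and>
     pseudo_riemannian_metric A (n + 1) n g \<and>
     (\<forall>p. \<phi> p (\<xi> p) = 0 \<and> \<eta> p (\<xi> p) = 1 \<and>
        (\<forall>x\<in>tangent_space A p.
           \<phi> p (\<phi> p x) = - x + \<eta> p x *\<^sub>R \<xi> p \<and> \<eta> p (\<phi> p x) = 0 \<and>
           (\<forall>y\<in>tangent_space A p. g p (\<phi> p x) (\<phi> p y) = - g p x y + \<eta> p x * \<eta> p y)))"

definition natural_connection ::
    "('a::{t2_space,second_countable_topology}, 'e::euclidean_space) atlas \<Rightarrow>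
     ('a \<Rightarrow> 'a functional \<Rightarrow> 'a functional) \<Rightarrow> ('a \<Rightarrow> 'a functional) \<Rightarrow>
     ('a \<Rightarrow> 'a functional \<Rightarrow> real) \<Rightarrow> ('a \<Rightarrow> 'a functional \<Rightarrow> 'a functional \<Rightarrow> real) \<Rightarrow>
     'a connection \<Rightarrow> bool" where
  "natural_connection A \<phi> \<xi> \<eta> g D \<longleftrightarrow>
     affine_connection A D \<and>
     (\<forall>p Y. \<forall>x\<in>tangent_space A p. vector_field_near A p Y \<longrightarrow>
        cov_endo D \<phi> p x Y = 0 \<and> cov_form D \<eta> p x Y = 0) \<and>
     (\<forall>p. \<forall>x\<in>tangent_space A p. D p x \<xi> = 0) \<and>
     metric_parallel A g D"

definition vert :: "('a \<Rightarrow> 'a functional) \<Rightarrow> ('a \<Rightarrow> 'a functional \<Rightarrow> real) \<Rightarrow>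
    'a \<Rightarrow> 'a functional \<Rightarrow> 'a functional" where
  "vert \<xi> \<eta> p x = \<eta> p x *\<^sub>R \<xi> p"

definition horiz :: "('a \<Rightarrow> 'a functional) \<Rightarrow> ('a \<Rightarrow> 'a functional \<Rightarrow> real) \<Rightarrow>
    'a \<Rightarrow> 'a functional \<Rightarrow> 'a functional" where
  "horiz \<xi> \<eta> p x = x - \<eta> p x *\<^sub>R \<xi> p"

definition schouten_van_kampen :: "('a \<Rightarrow> 'a functional) \<Rightarrow> ('a \<Rightarrow> 'a functional \<Rightarrow> real) \<Rightarrow>
    'a connection \<Rightarrow> 'a connection" where
  "schouten_van_kampen \<xi> \<eta> D p x Y =
     horiz \<xi> \<eta> p (D p x (\<lambda>q. horiz \<xi> \<eta> q (Y q))) + vert \<xi> \<eta> p (D p x (\<lambda>q. vert \<xi> \<eta> q (Y q)))"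

definition phiB_connection :: "('a \<Rightarrow> 'a functional \<Rightarrow> 'a functional) \<Rightarrow> ('a \<Rightarrow> 'a functional) \<Rightarrow>
    ('a \<Rightarrow> 'a functional \<Rightarrow> real) \<Rightarrow> 'a connection \<Rightarrow> 'a connection" where
  "phiB_connection \<phi> \<xi> \<eta> D p x Y =
     D p x Y + (1/2) *\<^sub>R (cov_endo D \<phi> p x (\<lambda>q. \<phi> q (Y q)) + cov_form D \<eta> p x Y *\<^sub>R \<xi> p)
       - \<eta> p (Y p) *\<^sub>R D p x \<xi>"

text \<open>The tensor \<open>F(x,y,z) = g((\<nabla>\<^sub>x\<phi>)y,z)\<close> at a point: \<open>(\<nabla>\<^sub>x\<phi>)y\<close> is computed with an arbitrary
  local extension of \<open>y\<close> to a vector field. It does not depend on the extension, because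
  \<^const>\<open>cov_endo\<close> is linear over smooth functions.\<close>

definition extend :: "('a::{t2_space,second_countable_topology}, 'e::euclidean_space) atlas \<Rightarrow>
    'a \<Rightarrow> 'a functional \<Rightarrow> 'a \<Rightarrow> 'a functional" where
  "extend A p y = (SOME Y. vector_field_near A p Y \<and> Y p = y)"

definition F_tensor :: "('a::{t2_space,second_countable_topology}, 'e::euclidean_space) atlas \<Rightarrow>
     ('a \<Rightarrow> 'a functional \<Rightarrow> 'a functional) \<Rightarrow> ('a \<Rightarrow> 'a functional \<Rightarrow> 'a functional \<Rightarrow> real) \<Rightarrow>
     'a connection \<Rightarrow> 'a \<Rightarrow> 'a functional \<Rightarrow> 'a functional \<Rightarrow> 'a functional \<Rightarrow> real" where
  "F_tensor A \<phi> g D p x y z = g p (cov_endo D \<phi> p x (extend A p y)) z"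


section \<open>The basic classes\<close>

text \<open>In this section \<open>V, \<phi>, \<xi>, \<eta>, g\<close> is the structure on a single tangent space and
  \<open>T\<close> is a trilinear form on \<open>V\<close>.\<close>

text \<open>The contraction \<open>g\<^sup>i\<^sup>j B(e\<^sub>i,e\<^sub>j)\<close>, where \<open>(e\<^sub>i)\<close> is any basis of \<open>V\<close> and
  \<open>(g\<^sup>i\<^sup>j)\<close> is the inverse of the matrix \<open>(g(e\<^sub>i,e\<^sub>j))\<close>. The value is independent of the basis.\<close>

definition metric_contraction :: "'v::real_vector set \<Rightarrow> ('v \<Rightarrow> 'v \<Rightarrow> real) \<Rightarrow> ('v \<Rightarrow> 'v \<Rightarrow> real) \<Rightarrow> real" where
  "metric_contraction V g B =
     (let m = dim V;
          e = (SOME e. basis_seq V m e);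
          G = (SOME G :: nat \<Rightarrow> nat \<Rightarrow> real. \<forall>i<m. \<forall>j<m.
                 (\<Sum>k<m. G i k * g (e k) (e j)) = (if i = j then 1 else 0))
      in \<Sum>i<m. \<Sum>j<m. G i j * B (e i) (e j))"

definition theta :: "'v::real_vector set \<Rightarrow> ('v \<Rightarrow> 'v \<Rightarrow> real) \<Rightarrow> ('v \<Rightarrow> 'v \<Rightarrow> 'v \<Rightarrow> real) \<Rightarrow> 'v \<Rightarrow> real" where
  "theta V g T z = metric_contraction V g (\<lambda>x y. T x y z)"

definition theta_star :: "'v::real_vector set \<Rightarrow> ('v \<Rightarrow> 'v) \<Rightarrow> ('v \<Rightarrow> 'v \<Rightarrow> real) \<Rightarrow>
    ('v \<Rightarrow> 'v \<Rightarrow> 'v \<Rightarrow> real) \<Rightarrow> 'v \<Rightarrow> real" where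
  "theta_star V \<phi> g T z = metric_contraction V g (\<lambda>x y. T x (\<phi> y) z)"

definition omega :: "'v \<Rightarrow> ('v \<Rightarrow> 'v \<Rightarrow> 'v \<Rightarrow> real) \<Rightarrow> 'v \<Rightarrow> real" where
  "omega \<xi> T z = T \<xi> \<xi> z"

definition F_like :: "'v::real_vector set \<Rightarrow> ('v \<Rightarrow> 'v) \<Rightarrow> 'v \<Rightarrow> ('v \<Rightarrow> real) \<Rightarrow>
    ('v \<Rightarrow> 'v \<Rightarrow> 'v \<Rightarrow> real) \<Rightarrow> bool" where
  "F_like V \<phi> \<xi> \<eta> T \<longleftrightarrow>
     (\<forall>y\<in>V. \<forall>z\<in>V. linear_map_on V (\<lambda>x. T x y z) \<and> linear_map_on V (\<lambda>x. T y x z) \<and>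
        linear_map_on V (\<lambda>x. T y z x)) \<and>
     (\<forall>x\<in>V. \<forall>y\<in>V. \<forall>z\<in>V. T x y z = T x z y \<and>
        T x y z = T x (\<phi> y) (\<phi> z) + \<eta> y * T x \<xi> z + \<eta> z * T x y \<xi>)"

definition F4_class :: "'v::real_vector set \<Rightarrow> nat \<Rightarrow> ('v \<Rightarrow> 'v) \<Rightarrow> 'v \<Rightarrow> ('v \<Rightarrow> real) \<Rightarrow>
    ('v \<Rightarrow> 'v \<Rightarrow> real) \<Rightarrow> ('v \<Rightarrow> 'v \<Rightarrow> 'v \<Rightarrow> real) set" where
  "F4_class V n \<phi> \<xi> \<eta> g = {T. F_like V \<phi> \<xi> \<eta> T \<and>
     (\<forall>x\<in>V. \<forall>y\<in>V. \<forall>z\<in>V. T x y z = - (theta V g T \<xi> / (2 * real n)) *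
        (g (\<phi> x) (\<phi> y) * \<eta> z + g (\<phi> x) (\<phi> z) * \<eta> y))}"

definition F5_class :: "'v::real_vector set \<Rightarrow> nat \<Rightarrow> ('v \<Rightarrow> 'v) \<Rightarrow> 'v \<Rightarrow> ('v \<Rightarrow> real) \<Rightarrow>
    ('v \<Rightarrow> 'v \<Rightarrow> real) \<Rightarrow> ('v \<Rightarrow> 'v \<Rightarrow> 'v \<Rightarrow> real) set" where
  "F5_class V n \<phi> \<xi> \<eta> g = {T. F_like V \<phi> \<xi> \<eta> T \<and>
     (\<forall>x\<in>V. \<forall>y\<in>V. \<forall>z\<in>V. T x y z = - (theta_star V \<phi> g T \<xi> / (2 * real n)) *
        (g x (\<phi> y) * \<eta> z + g x (\<phi> z) * \<eta> y))}"

definition F6_9_form :: "'v::real_vector set \<Rightarrow> 'v \<Rightarrow> ('v \<Rightarrow> real) \<Rightarrow>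
    ('v \<Rightarrow> 'v \<Rightarrow> 'v \<Rightarrow> real) \<Rightarrow> bool" where
  "F6_9_form V \<xi> \<eta> T \<longleftrightarrow>
     (\<forall>x\<in>V. \<forall>y\<in>V. \<forall>z\<in>V. T x y z = T x y \<xi> * \<eta> z + T x z \<xi> * \<eta> y)"

definition F6_class :: "'v::real_vector set \<Rightarrow> ('v \<Rightarrow> 'v) \<Rightarrow> 'v \<Rightarrow> ('v \<Rightarrow> real) \<Rightarrow>
    ('v \<Rightarrow> 'v \<Rightarrow> real) \<Rightarrow> ('v \<Rightarrow> 'v \<Rightarrow> 'v \<Rightarrow> real) set" where
  "F6_class V \<phi> \<xi> \<eta> g = {T. F_like V \<phi> \<xi> \<eta> T \<and> F6_9_form V \<xi> \<eta> T \<and>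
     (\<forall>x\<in>V. \<forall>y\<in>V. T x y \<xi> = T y x \<xi> \<and> T x y \<xi> = - T (\<phi> x) (\<phi> y) \<xi>) \<and>
     (\<forall>z\<in>V. theta V g T z = 0 \<and> theta_star V \<phi> g T z = 0)}"

definition F7_class :: "'v::real_vector set \<Rightarrow> ('v \<Rightarrow> 'v) \<Rightarrow> 'v \<Rightarrow> ('v \<Rightarrow> real) \<Rightarrow>
    ('v \<Rightarrow> 'v \<Rightarrow> 'v \<Rightarrow> real) set" where
  "F7_class V \<phi> \<xi> \<eta> = {T. F_like V \<phi> \<xi> \<eta> T \<and> F6_9_form V \<xi> \<eta> T \<and>
     (\<forall>x\<in>V. \<forall>y\<in>V. T x y \<xi> = - T y x \<xi> \<and> T x y \<xi> = - T (\<phi> x) (\<phi> y) \<xi>)}"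

definition F8_class :: "'v::real_vector set \<Rightarrow> ('v \<Rightarrow> 'v) \<Rightarrow> 'v \<Rightarrow> ('v \<Rightarrow> real) \<Rightarrow>
    ('v \<Rightarrow> 'v \<Rightarrow> 'v \<Rightarrow> real) set" where
  "F8_class V \<phi> \<xi> \<eta> = {T. F_like V \<phi> \<xi> \<eta> T \<and> F6_9_form V \<xi> \<eta> T \<and>
     (\<forall>x\<in>V. \<forall>y\<in>V. T x y \<xi> = T y x \<xi> \<and> T x y \<xi> = T (\<phi> x) (\<phi> y) \<xi>)}"

definition F9_class :: "'v::real_vector set \<Rightarrow> ('v \<Rightarrow> 'v) \<Rightarrow> 'v \<Rightarrow> ('v \<Rightarrow> real) \<Rightarrow>
    ('v \<Rightarrow> 'v \<Rightarrow> 'v \<Rightarrow> real) set" where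
  "F9_class V \<phi> \<xi> \<eta> = {T. F_like V \<phi> \<xi> \<eta> T \<and> F6_9_form V \<xi> \<eta> T \<and>
     (\<forall>x\<in>V. \<forall>y\<in>V. T x y \<xi> = - T y x \<xi> \<and> T x y \<xi> = T (\<phi> x) (\<phi> y) \<xi>)}"

definition F11_class :: "'v::real_vector set \<Rightarrow> ('v \<Rightarrow> 'v) \<Rightarrow> 'v \<Rightarrow> ('v \<Rightarrow> real) \<Rightarrow>
    ('v \<Rightarrow> 'v \<Rightarrow> 'v \<Rightarrow> real) set" where
  "F11_class V \<phi> \<xi> \<eta> = {T. F_like V \<phi> \<xi> \<eta> T \<and>
     (\<forall>x\<in>V. \<forall>y\<in>V. \<forall>z\<in>V. T x y z = \<eta> x * (\<eta> y * omega \<xi> T z + \<eta> z * omega \<xi> T y))}"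

definition U2_class :: "'v::real_vector set \<Rightarrow> nat \<Rightarrow> ('v \<Rightarrow> 'v) \<Rightarrow> 'v \<Rightarrow> ('v \<Rightarrow> real) \<Rightarrow>
    ('v \<Rightarrow> 'v \<Rightarrow> real) \<Rightarrow> ('v \<Rightarrow> 'v \<Rightarrow> 'v \<Rightarrow> real) set" where
  "U2_class V n \<phi> \<xi> \<eta> g = {T.
     \<exists>T4\<in>F4_class V n \<phi> \<xi> \<eta> g. \<exists>T5\<in>F5_class V n \<phi> \<xi> \<eta> g. \<exists>T6\<in>F6_class V \<phi> \<xi> \<eta> g.
     \<exists>T7\<in>F7_class V \<phi> \<xi> \<eta>. \<exists>T8\<in>F8_class V \<phi> \<xi> \<eta>. \<exists>T9\<in>F9_class V \<phi> \<xi> \<eta>.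
     \<exists>T11\<in>F11_class V \<phi> \<xi> \<eta>. \<forall>x\<in>V. \<forall>y\<in>V. \<forall>z\<in>V.
       T x y z = T4 x y z + T5 x y z + T6 x y z + T7 x y z + T8 x y z + T9 x y z + T11 x y z}"

definition belongs_to_U2 ::
    "('a::{t2_space,second_countable_topology}, 'e::euclidean_space) atlas \<Rightarrow> nat \<Rightarrow>
     ('a \<Rightarrow> 'a functional \<Rightarrow> 'a functional) \<Rightarrow> ('a \<Rightarrow> 'a functional) \<Rightarrow>
     ('a \<Rightarrow> 'a functional \<Rightarrow> real) \<Rightarrow> ('a \<Rightarrow> 'a functional \<Rightarrow> 'a functional \<Rightarrow> real) \<Rightarrow>
     'a connection \<Rightarrow> bool" where
  "belongs_to_U2 A n \<phi> \<xi> \<eta> g D \<longleftrightarrow>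
     (\<forall>p. F_tensor A \<phi> g D p \<in> U2_class (tangent_space A p) n (\<phi> p) (\<xi> p) (\<eta> p) (g p))"

end

theory Submission
  imports Defs
begin

text \<open>
Write \<open>\<nabla>\<close> for the Levi-Civita connection, \<open>\<nabla>\<^sup>0\<close> for the Schouten-van Kampen connection and
\<open>F(x,y,z) = g((\<nabla>\<^sub>x\<phi>)y,z)\<close>. Since \<open>g(\<xi>,\<xi>) = 1\<close>, the vector \<open>\<nabla>\<^sub>x\<xi>\<close> is horizontal, and expanding the
definition gives
\<open>\<nabla>\<^sup>0\<^sub>xy = \<nabla>\<^sub>xy - \<eta>(y) \<nabla>\<^sub>x\<xi> + (\<nabla>\<^sub>x\<eta>)(y) \<xi>\<close> (lemma \<open>svk_eq\<close>). From this formula \<open>\<xi>\<close>, \<open>\<eta>\<close> and \<open>g\<close>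
are always parallel for \<open>\<nabla>\<^sup>0\<close>, so that naturality is a condition on \<open>\<phi>\<close> alone, and
\<open>g((\<nabla>\<^sup>0\<^sub>x\<phi>)y,z) = F(x,y,z) - F(x,y,\<xi>) \<eta>(z) - F(x,z,\<xi>) \<eta>(y)\<close> (lemma \<open>svk_phi_metric\<close>). As \<open>g\<close> is
nondegenerate, \<open>\<nabla>\<^sup>0\<close> is natural if and only if \<open>F\<close> has the form
\<open>F(x,y,z) = F(x,y,\<xi>) \<eta>(z) + F(x,z,\<xi>) \<eta>(y)\<close> at every point (lemma \<open>svk_phi_parallel_iff\<close>).

It remains to see, in the linear algebra of one tangent space, that this form characterises
\<^const>\<open>U2_class\<close> among the tensors with the algebraic properties of \<open>F\<close>.
All seven classes have it. Conversely such a tensor is determined by the bilinear form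
\<open>B(x,y) = F(x,y,\<xi>)\<close>. The part \<open>\<eta>(x) B(\<xi>,y)\<close> gives the component in \<^const>\<open>F11_class\<close>. The rest
vanishes when an argument is \<open>\<xi>\<close>, and splits into four parts according to the two commuting
involutions given by exchanging the arguments and by applying \<open>\<phi>\<close> to both. Three parts give the
components in \<^const>\<open>F7_class\<close>, \<^const>\<open>F8_class\<close> and \<^const>\<open>F9_class\<close>. From the fourth one, symmetric
and changing sign under \<open>\<phi>\<close>, multiples of \<open>g(\<phi>x,\<phi>y)\<close> and \<open>g(x,\<phi>y)\<close> are subtracted to remove its two
traces. What is subtracted gives the components in \<^const>\<open>F4_class\<close> and \<^const>\<open>F5_class\<close>, the remainder
the one in \<^const>\<open>F6_class\<close> (lemma \<open>form_imp_U2_class\<close>).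

Finally, for natural \<open>\<nabla>\<^sup>0\<close> the equation \<open>(\<nabla>\<^sup>0\<^sub>x\<phi>)\<phi>y = 0\<close> says that \<open>(\<nabla>\<^sub>x\<phi>)\<phi>y\<close> is the multiple \<open>(\<nabla>\<^sub>x\<eta>)(y)\<close>
of \<open>\<xi>\<close>, which turns the definition of the \<open>\<phi>\<close>B-connection into the formula for \<open>\<nabla>\<^sup>0\<close>.

Evaluating \<open>F\<close> at tangent vectors needs two facts about the manifold. Every tangent vector extends
to a local vector field (lemma \<open>tangent_vector_extends\<close>); and \<open>(\<nabla>\<^sub>x\<phi>)Y\<close> depends on \<open>Y\<close> only through
its value at the point (lemma \<open>D_phi_tensorial\<close>), because \<open>\<nabla>\<^sub>x\<phi>\<close> is self-adjoint.
\<close>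

section \<open>Calculus of smooth functions\<close>

lemma differentiable_cong_open:
  assumes "open S" "x \<in> S" "\<And>y. y \<in> S \<Longrightarrow> f y = g y" "f differentiable (at x)"
  shows "g differentiable (at x)" "frechet_derivative g (at x) = frechet_derivative f (at x)"
proof -
  have "(f has_derivative frechet_derivative f (at x)) (at x)"
    using assms(4) frechet_derivative_works by blast
  then have g: "(g has_derivative frechet_derivative f (at x)) (at x)"
    using has_derivative_transform_within_open assms(1-3) by blast
  show "g differentiable (at x)" using g by (auto simp: differentiable_def)
  show "frechet_derivative g (at x) = frechet_derivative f (at x)"
    using frechet_derivative_at[OF g] by simp
qed

text \<open>Openness of the domain makes the derivatives agree as well, so the induction goes through; this
  is what allows derivatives to be replaced by their closed forms in the lemmas below.\<close>

lemma C_k_on_cong: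
  assumes "open S" "\<And>x. x \<in> S \<Longrightarrow> f x = g x" "C_k_on k S f"
  shows "C_k_on k S g"
  using assms(2,3)
proof (induction k arbitrary: f g)
  case 0
  then show ?case using continuous_on_cong[of S S f g] by simp
next
  case (Suc k)
  have "C_k_on k S (\<lambda>x. frechet_derivative g (at x) v)" for v
  proof (rule Suc.IH)
    show "C_k_on k S (\<lambda>x. frechet_derivative f (at x) v)" using Suc.prems(2) by simp
    show "frechet_derivative f (at x) v = frechet_derivative g (at x) v" if "x \<in> S" for x
      using differentiable_cong_open(2)[OF assms(1) that Suc.prems(1)] Suc.prems(2) that by simp
  qed
  moreover have "\<forall>x\<in>S. g differentiable (at x)"
    using differentiable_cong_open(1)[OF assms(1) _ Suc.prems(1)] Suc.prems(2) by simp
  ultimately show ?case by simp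
qed

lemma C_k_on_subset: "C_k_on k S f \<Longrightarrow> T \<subseteq> S \<Longrightarrow> C_k_on k T f"
  by (induction k arbitrary: f) (auto intro: continuous_on_subset)

lemma C_k_on_SucD: "C_k_on (Suc k) S f \<Longrightarrow> C_k_on k S f"
proof (induction k arbitrary: f)
  case 0
  then show ?case
    by (auto intro!: continuous_at_imp_continuous_on differentiable_imp_continuous_within)
next
  case (Suc k)
  then show ?case by (metis C_k_on.simps(2))
qed

lemma C_k_on_const: "C_k_on k S (\<lambda>x. a)"
  by (induction k arbitrary: a) (auto simp: frechet_derivative_const)

lemma C_k_on_linear:
  assumes L: "bounded_linear L" and f: "C_k_on k S f" and S: "open S"
  shows "C_k_on k S (\<lambda>x. L (f x))"
  using f
proof (induction k arbitrary: f)
  case 0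
  then show ?case using L by (auto intro: bounded_linear.continuous_on)
next
  case (Suc k)
  have d: "((\<lambda>x. L (f x)) has_derivative (\<lambda>v. L (frechet_derivative f (at x) v))) (at x)"
    if "x \<in> S" for x
    using Suc.prems that by (auto intro!: bounded_linear.has_derivative[OF L]
        simp: frechet_derivative_works[symmetric])
  have "C_k_on k S (\<lambda>x. frechet_derivative (\<lambda>x. L (f x)) (at x) v)" for v
  proof (rule C_k_on_cong[OF S])
    show "C_k_on k S (\<lambda>x. L (frechet_derivative f (at x) v))"
      using Suc.prems by (auto intro: Suc.IH)
    show "L (frechet_derivative f (at x) v) = frechet_derivative (\<lambda>x. L (f x)) (at x) v"
      if "x \<in> S" for x
      using frechet_derivative_at[OF d[OF that]] by metis
  qed
  then show ?case using d by (auto simp: differentiable_def)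
qed

lemma C_k_on_add:
  assumes "C_k_on k S f" "C_k_on k S g" "open S"
  shows "C_k_on k S (\<lambda>x. f x + g x)"
  using assms(1,2)
proof (induction k arbitrary: f g)
  case 0
  then show ?case by (auto intro: continuous_on_add)
next
  case (Suc k)
  have d: "((\<lambda>x. f x + g x) has_derivative
      (\<lambda>v. frechet_derivative f (at x) v + frechet_derivative g (at x) v)) (at x)"
    if "x \<in> S" for x
    using Suc.prems that by (auto intro!: has_derivative_add simp: frechet_derivative_works[symmetric])
  have "C_k_on k S (\<lambda>x. frechet_derivative (\<lambda>x. f x + g x) (at x) v)" for v
  proof (rule C_k_on_cong[OF assms(3)])
    show "C_k_on k S (\<lambda>x. frechet_derivative f (at x) v + frechet_derivative g (at x) v)"
      using Suc.prems by (auto intro: Suc.IH)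
    show "frechet_derivative f (at x) v + frechet_derivative g (at x) v =
        frechet_derivative (\<lambda>x. f x + g x) (at x) v" if "x \<in> S" for x
      using frechet_derivative_at[OF d[OF that]] by metis
  qed
  then show ?case using d by (auto simp: differentiable_def)
qed

lemma C_k_on_mult:
  fixes f g :: "'b::real_normed_vector \<Rightarrow> real"
  assumes "C_k_on k S f" "C_k_on k S g" "open S"
  shows "C_k_on k S (\<lambda>x. f x * g x)"
  using assms(1,2)
proof (induction k arbitrary: f g)
  case 0
  then show ?case by (auto intro: continuous_on_mult)
next
  case (Suc k)
  have d: "((\<lambda>x. f x * g x) has_derivative
      (\<lambda>v. f x * frechet_derivative g (at x) v + frechet_derivative f (at x) v * g x)) (at x)"
    if "x \<in> S" for x
    using Suc.prems that by (auto intro!: has_derivative_mult simp: frechet_derivative_works[symmetric])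
  have "C_k_on k S (\<lambda>x. frechet_derivative (\<lambda>x. f x * g x) (at x) v)" for v
  proof (rule C_k_on_cong[OF assms(3)])
    show "C_k_on k S (\<lambda>x. f x * frechet_derivative g (at x) v + frechet_derivative f (at x) v * g x)"
      using Suc.prems Suc.prems[THEN C_k_on_SucD] by (auto intro!: C_k_on_add Suc.IH assms(3))
    show "f x * frechet_derivative g (at x) v + frechet_derivative f (at x) v * g x =
        frechet_derivative (\<lambda>x. f x * g x) (at x) v" if "x \<in> S" for x
      using frechet_derivative_at[OF d[OF that]] by metis
  qed
  then show ?case using d by (auto simp: differentiable_def)
qed

lemma C_k_on_sum:
  assumes "\<And>i. i \<in> I \<Longrightarrow> C_k_on k S (f i)" "open S"
  shows "C_k_on k S (\<lambda>x. \<Sum>i\<in>I. f i x)"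
  using assms(1) by (induction I rule: infinite_finite_induct)
    (auto intro: C_k_on_const C_k_on_add assms(2))

text \<open>In the chain rule \<open>D(f \<circ> g)(x)v = Df(g x)(Dg(x)v)\<close> the direction depends on \<open>x\<close>, whereas
  \<^const>\<open>C_k_on\<close> differentiates in fixed directions only. Expanding the inner vector in the standard
  basis leaves a sum of products in which all directions are constant.\<close>

lemma C_k_on_compose:
  fixes f :: "'c::euclidean_space \<Rightarrow> real" and g :: "'b::real_normed_vector \<Rightarrow> 'c"
  assumes "C_k_on k T f" "C_k_on k S g" "open S" "open T" "g ` S \<subseteq> T"
  shows "C_k_on k S (\<lambda>x. f (g x))"
  using assms(1,2)
proof (induction k arbitrary: f)
  case 0
  then show ?case using assms(5) by (auto intro: continuous_on_compose2)
next
  case (Suc k)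
  have d: "((\<lambda>x. f (g x)) has_derivative
      (\<lambda>v. frechet_derivative f (at (g x)) (frechet_derivative g (at x) v))) (at x)"
    if "x \<in> S" for x
  proof -
    have "(g has_derivative frechet_derivative g (at x)) (at x)"
      using Suc.prems(2) that by (simp add: frechet_derivative_works[symmetric])
    moreover have "(f has_derivative frechet_derivative f (at (g x))) (at (g x))"
      using Suc.prems(1) that assms(5) by (auto simp: frechet_derivative_works[symmetric])
    ultimately show ?thesis by (rule has_derivative_compose)
  qed
  have e: "frechet_derivative (\<lambda>x. f (g x)) (at x) v =
        (\<Sum>b\<in>Basis. (frechet_derivative g (at x) v \<bullet> b) * frechet_derivative f (at (g x)) b)"
    if x: "x \<in> S" for x v
  proof -
    have "linear (frechet_derivative f (at (g x)))"
      using Suc.prems(1) x assms(5) by (auto intro: linear_frechet_derivative)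
    then have "frechet_derivative f (at (g x)) w =
        (\<Sum>b\<in>Basis. (w \<bullet> b) * frechet_derivative f (at (g x)) b)" for w
      by (subst (1) euclidean_representation[symmetric])
         (simp add: linear_sum linear_cmul)
    then show ?thesis using frechet_derivative_at[OF d[OF x]] by metis
  qed
  have "C_k_on k S (\<lambda>x. frechet_derivative (\<lambda>x. f (g x)) (at x) v)" for v
  proof (rule C_k_on_cong[OF assms(3) e[symmetric]])
    show "C_k_on k S (\<lambda>x. \<Sum>b\<in>Basis. (frechet_derivative g (at x) v \<bullet> b) *
        frechet_derivative f (at (g x)) b)"
      using Suc.prems
      by (intro C_k_on_sum C_k_on_mult assms(3) Suc.IH C_k_on_linear[OF bounded_linear_inner_left])
        (auto intro: C_k_on_SucD)
  qed auto
  then show ?case using d by (auto simp: differentiable_def)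
qed

lemma smooth_on_cong:
  "open S \<Longrightarrow> (\<And>x. x \<in> S \<Longrightarrow> f x = g x) \<Longrightarrow> smooth_on S f \<Longrightarrow> smooth_on S g"
  unfolding smooth_on_def using C_k_on_cong by metis

lemma smooth_on_subset: "smooth_on S f \<Longrightarrow> T \<subseteq> S \<Longrightarrow> smooth_on T f"
  by (auto simp: smooth_on_def intro: C_k_on_subset)

lemma smooth_on_compose:
  fixes f :: "'c::euclidean_space \<Rightarrow> real" and g :: "'b::real_normed_vector \<Rightarrow> 'c"
  assumes "smooth_on T f" "smooth_on S g" "open S" "open T" "g ` S \<subseteq> T"
  shows "smooth_on S (\<lambda>x. f (g x))"
  using assms C_k_on_compose[of _ T f S g] unfolding smooth_on_def by blast

lemma smooth_on_derivative:
  "smooth_on S f \<Longrightarrow> smooth_on S (\<lambda>x. frechet_derivative f (at x) v)"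
  unfolding smooth_on_def by (metis C_k_on.simps(2))

lemma smooth_on_differentiable: "smooth_on S f \<Longrightarrow> x \<in> S \<Longrightarrow> f differentiable (at x)"
  unfolding smooth_on_def by (metis C_k_on.simps(2))

section \<open>Tangent vectors and vector fields on a smooth manifold\<close>

locale manifold =
  fixes A :: "('a::{t2_space,second_countable_topology}, 'e::euclidean_space) atlas"
  assumes manifold: "smooth_manifold A"
begin

lemma chart_facts:
  assumes "(U, c) \<in> A"
  shows chart_open: "open U"
    and chart_homeomorphism: "homeomorphism U (c ` U) c (inv_into U c)"
    and chart_inv: "q \<in> U \<Longrightarrow> inv_into U c (c q) = q"
    and chart_transition: "(V, d) \<in> A \<Longrightarrow> smooth_on (c ` (U \<inter> V)) (d \<circ> inv_into U c)"
proof -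
  show "open U" and h: "homeomorphism U (c ` U) c (inv_into U c)"
    using manifold assms unfolding smooth_manifold_def by blast+
  show "q \<in> U \<Longrightarrow> inv_into U c (c q) = q"
    using h by (simp add: homeomorphism_apply1)
  show "(V, d) \<in> A \<Longrightarrow> smooth_on (c ` (U \<inter> V)) (d \<circ> inv_into U c)"
    using manifold assms unfolding smooth_manifold_def by blast
qed

lemma chart_cover: obtains U c where "(U, c) \<in> A" "p \<in> U"
  using manifold unfolding smooth_manifold_def by blast

lemma chart_image_open:
  assumes "(U, c) \<in> A" "open W"
  shows "open (c ` (U \<inter> W))"
proof -
  have "openin (top_of_set (c ` U)) (c ` (U \<inter> W))"
    using homeomorphism_imp_open_map[OF chart_homeomorphism[OF assms(1)]] assms(2)
    by (simp add: openin_open_Int)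
  moreover have "open (c ` U)"
    using manifold assms(1) unfolding smooth_manifold_def by blast
  ultimately show ?thesis using openin_open_trans by blast
qed

lemma smooth_near_cong:
  assumes f: "smooth_near A p f" and eq: "\<forall>\<^sub>F q in nhds p. f q = g q"
  shows "smooth_near A p g"
proof -
  obtain W where W: "open W" "p \<in> W"
    "\<And>U c. (U, c) \<in> A \<Longrightarrow> smooth_on (c ` (U \<inter> W)) (f \<circ> inv_into U c)"
    using f unfolding smooth_near_def by blast
  obtain W' where W': "open W'" "p \<in> W'" "\<And>q. q \<in> W' \<Longrightarrow> f q = g q"
    using eq unfolding eventually_nhds by blast
  have "smooth_on (c ` (U \<inter> (W \<inter> W'))) (g \<circ> inv_into U c)" if c: "(U, c) \<in> A" for U c
  proof (rule smooth_on_cong)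
    show "open (c ` (U \<inter> (W \<inter> W')))"
      using chart_image_open[OF c] W W' by blast
    show "smooth_on (c ` (U \<inter> (W \<inter> W'))) (f \<circ> inv_into U c)"
      by (rule smooth_on_subset[OF W(3)[OF c]]) auto
    show "(f \<circ> inv_into U c) y = (g \<circ> inv_into U c) y" if "y \<in> c ` (U \<inter> (W \<inter> W'))" for y
      using that W'(3) chart_inv[OF c] by auto
  qed
  then show ?thesis
    unfolding smooth_near_def using W W' by (intro exI[of _ "W \<inter> W'"]) auto
qed

lemma smooth_near_const: "smooth_near A p (\<lambda>q. a)"
  unfolding smooth_near_def smooth_on_def by (auto simp: o_def intro!: C_k_on_const exI[of _ UNIV])

lemma smooth_near_zero: "\<forall>\<^sub>F q in nhds p. f q = 0 \<Longrightarrow> smooth_near A p f"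
  by (rule smooth_near_cong[OF smooth_near_const[of p 0]]) (auto elim: eventually_mono)

lemma smooth_near_add_mult:
  assumes f: "smooth_near A p f" and g: "smooth_near A p g"
  shows smooth_near_add: "smooth_near A p (\<lambda>q. f q + g q)"
    and smooth_near_mult: "smooth_near A p (\<lambda>q. f q * g q)"
proof -
  obtain W where W: "open W" "p \<in> W"
    "\<And>U c. (U, c) \<in> A \<Longrightarrow> smooth_on (c ` (U \<inter> W)) (f \<circ> inv_into U c)"
    using f unfolding smooth_near_def by blast
  obtain W' where W': "open W'" "p \<in> W'"
    "\<And>U c. (U, c) \<in> A \<Longrightarrow> smooth_on (c ` (U \<inter> W')) (g \<circ> inv_into U c)"
    using g unfolding smooth_near_def by blast
  have open_W: "open (c ` (U \<inter> (W \<inter> W')))" if c: "(U, c) \<in> A" for U c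
    by (intro chart_image_open[OF c] open_Int W(1) W'(1))
  have f_W: "smooth_on (c ` (U \<inter> (W \<inter> W'))) (f \<circ> inv_into U c)" if c: "(U, c) \<in> A" for U c
    by (rule smooth_on_subset[OF W(3)[OF c]]) blast
  have g_W: "smooth_on (c ` (U \<inter> (W \<inter> W'))) (g \<circ> inv_into U c)" if c: "(U, c) \<in> A" for U c
    by (rule smooth_on_subset[OF W'(3)[OF c]]) blast
  note * = open_W f_W g_W
  show "smooth_near A p (\<lambda>q. f q + g q)"
    unfolding smooth_near_def smooth_on_def
    using W W' *[unfolded smooth_on_def]
    by (intro exI[of _ "W \<inter> W'"]) (auto simp: o_def intro!: C_k_on_add)
  show "smooth_near A p (\<lambda>q. f q * g q)"
    unfolding smooth_near_def smooth_on_def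
    using W W' *[unfolded smooth_on_def]
    by (intro exI[of _ "W \<inter> W'"]) (auto simp: o_def intro!: C_k_on_mult)
qed

lemma tangent_spaceD:
  assumes "v \<in> tangent_space A p"
  shows tangent_add: "smooth_near A p f \<Longrightarrow> smooth_near A p g \<Longrightarrow>
      act v (\<lambda>q. f q + g q) = act v f + act v g"
    and tangent_mult: "smooth_near A p f \<Longrightarrow> smooth_near A p g \<Longrightarrow>
      act v (\<lambda>q. f q * g q) = act v f * g p + f p * act v g"
    and tangent_scale: "smooth_near A p f \<Longrightarrow> act v (\<lambda>q. a * f q) = a * act v f"
    and tangent_not_smooth: "\<not> smooth_near A p f \<Longrightarrow> act v f = 0"
proof -
  note v = assms[unfolded tangent_space_def mem_Collect_eq]
  note v1 = v[THEN conjunct1, rule_format, of f g]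
  note v2 = v[THEN conjunct2, THEN conjunct1, rule_format, of f a]
  note v3 = v[THEN conjunct2, THEN conjunct2, rule_format, of f]
  show "act v (\<lambda>q. f q + g q) = act v f + act v g" if "smooth_near A p f" "smooth_near A p g"
    using v1[OF that] by (rule conjunct1)
  show "act v (\<lambda>q. f q * g q) = act v f * g p + f p * act v g"
    if "smooth_near A p f" "smooth_near A p g"
    using v1[OF that] by (rule conjunct2)
  show "act v (\<lambda>q. a * f q) = a * act v f" if "smooth_near A p f"
    using v2[OF that] .
  show "act v f = 0" if "\<not> smooth_near A p f"
    using v3[OF that] .
qed

lemma tangent_const: "v \<in> tangent_space A p \<Longrightarrow> act v (\<lambda>q. a) = 0"
proof -
  assume v: "v \<in> tangent_space A p"
  \<comment> \<open>The product rule for \<open>1 = 1 \<cdot> 1\<close> gives \<open>v(1) = 2 v(1)\<close>.\<close>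
  have "act v (\<lambda>q. 1 * 1) = act v (\<lambda>q. 1) * 1 + 1 * act v (\<lambda>q. 1)"
    using tangent_mult[OF v smooth_near_const smooth_near_const] .
  then show ?thesis using tangent_scale[OF v smooth_near_const, of a 1] by simp
qed

lemma subspace_tangent_space: "subspace (tangent_space A p)"
  unfolding subspace_def tangent_space_def by (auto simp: algebra_simps)

text \<open>An indicator function of the complement of a neighbourhood of \<open>p\<close> vanishes near \<open>p\<close> and is
  therefore smooth there. The product rule for \<open>\<rho>\<close> times a function or vector field that vanishes
  wherever \<open>P\<close> holds shows that derivations and connections depend only on germs at \<open>p\<close>.\<close>

lemma cutoff:
  assumes "\<forall>\<^sub>F q in nhds p. P q"
  obtains \<rho> :: "'a \<Rightarrow> real" where "smooth_near A p \<rho>" "\<rho> p = 0" "\<And>q. \<not> P q \<Longrightarrow> \<rho> q = 1"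
proof -
  obtain W where W: "open W" "p \<in> W" "\<And>q. q \<in> W \<Longrightarrow> P q"
    using assms unfolding eventually_nhds by blast
  have "\<forall>\<^sub>F q in nhds p. (if q \<in> W then 0 else 1 :: real) = 0"
    unfolding eventually_nhds using W by (intro exI[of _ W]) auto
  then have "smooth_near A p (\<lambda>q. if q \<in> W then 0 else 1)"
    by (rule smooth_near_zero)
  moreover have "(if q \<in> W then 0 else 1 :: real) = 1" if "\<not> P q" for q
    using W(3) that by auto
  ultimately show ?thesis using that[of "\<lambda>q. if q \<in> W then 0 else 1"] W(2) by simp
qed

lemma act_cong:
  assumes v: "v \<in> tangent_space A p" and eq: "\<forall>\<^sub>F q in nhds p. f q = g q"
  shows "act v f = act v g"
proof (cases "smooth_near A p f")
  case True
  let ?d = "\<lambda>q. g q + (-1) * f q"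
  obtain \<rho> where \<rho>: "smooth_near A p \<rho>" "\<rho> p = 0" "\<And>q. f q \<noteq> g q \<Longrightarrow> \<rho> q = 1"
    using cutoff[OF eq] by blast
  have d: "smooth_near A p ?d"
    by (intro smooth_near_add smooth_near_mult smooth_near_const smooth_near_cong[OF True eq] True)
  have "?d p = 0" using eventually_nhds_x_imp_x[OF eq] by simp
  moreover have "?d = (\<lambda>q. \<rho> q * ?d q)" using \<rho>(3) by force
  ultimately have "act v ?d = 0"
    using tangent_mult[OF v \<rho>(1) d] \<rho>(2) by simp
  moreover have "act v (\<lambda>q. f q + ?d q) = act v f + act v ?d"
    by (rule tangent_add[OF v True d])
  ultimately show ?thesis by simp
next
  case False
  moreover have "\<forall>\<^sub>F q in nhds p. g q = f q" using eq by eventually_elim simp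
  ultimately have "\<not> smooth_near A p g" using smooth_near_cong by blast
  then show ?thesis using False tangent_not_smooth[OF v] by simp
qed

lemma vector_field_near_tangent: "vector_field_near A p X \<Longrightarrow> X p \<in> tangent_space A p"
  using eventually_nhds_x_imp_x[of "\<lambda>q. X q \<in> tangent_space A q" p]
  unfolding vector_field_near_def by simp

lemma vector_field_near_eventually:
  "vector_field_near A p X \<Longrightarrow> \<forall>\<^sub>F q in nhds p. X q \<in> tangent_space A q"
  unfolding vector_field_near_def by blast

lemma vector_field_near_cong:
  assumes X: "vector_field_near A p X" and eq: "\<forall>\<^sub>F q in nhds p. X q = Y q"
  shows "vector_field_near A p Y"
  unfolding vector_field_near_def
proof (intro conjI allI impI)
  show "\<forall>\<^sub>F q in nhds p. Y q \<in> tangent_space A q"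
    using eq vector_field_near_eventually[OF X] by eventually_elim simp
  show "smooth_near A p (\<lambda>q. act (Y q) f)" if "smooth_near A p f" for f
  proof (rule smooth_near_cong)
    show "smooth_near A p (\<lambda>q. act (X q) f)" using X that unfolding vector_field_near_def by blast
    show "\<forall>\<^sub>F q in nhds p. act (X q) f = act (Y q) f" using eq by eventually_elim simp
  qed
qed

lemma vector_field_near_add:
  assumes "vector_field_near A p X" "vector_field_near A p Y"
  shows "vector_field_near A p (\<lambda>q. X q + Y q)"
  using assms subspace_add[OF subspace_tangent_space]
  unfolding vector_field_near_def by (auto intro: smooth_near_add elim: eventually_elim2)

lemma vector_field_near_scale:
  assumes "smooth_near A p f" "vector_field_near A p X"
  shows "vector_field_near A p (\<lambda>q. f q *\<^sub>R X q)"
  using assms subspace_scale[OF subspace_tangent_space]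
  unfolding vector_field_near_def by (auto intro: smooth_near_mult elim: eventually_mono)

lemma vector_field_near_diff:
  assumes "vector_field_near A p X" "vector_field_near A p Y"
  shows "vector_field_near A p (\<lambda>q. X q - Y q)"
  using vector_field_near_add[OF assms(1) vector_field_near_scale[OF smooth_near_const[of p "-1"] assms(2)]]
  by simp

lemma smooth_near_coordinate:
  assumes c: "(U, c) \<in> A" and p: "p \<in> U"
  shows "smooth_near A p (\<lambda>q. c q \<bullet> b)"
  unfolding smooth_near_def
proof (intro exI[of _ U] conjI ballI, safe)
  show "open U" "p \<in> U" using chart_open[OF c] p by auto
  fix V d assume d: "(V, d) \<in> A"
  have "smooth_on (d ` (V \<inter> U)) (\<lambda>x. (c \<circ> inv_into V d) x \<bullet> b)"
    using chart_transition[OF d c] chart_image_open[OF d chart_open[OF c]]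
    unfolding smooth_on_def by (blast intro: C_k_on_linear[OF bounded_linear_inner_left])
  then show "smooth_on (d ` (V \<inter> U)) ((\<lambda>q. c q \<bullet> b) \<circ> inv_into V d)"
    by (simp add: o_def)
qed

text \<open>The derivative in the fixed direction \<open>v\<close> of the chart; the default value is the one prescribed
  for tangent vectors.\<close>

definition coordinate_field :: "'a set \<Rightarrow> ('a \<Rightarrow> 'e) \<Rightarrow> 'e \<Rightarrow> 'a \<Rightarrow> 'a functional" where
  "coordinate_field U c v q = Functional (\<lambda>f. if smooth_near A q f
     then frechet_derivative (f \<circ> inv_into U c) (at (c q)) v else 0)"

lemma smooth_near_has_derivative:
  assumes c: "(U, c) \<in> A" and q: "q \<in> U" and f: "smooth_near A q f"
  shows "(f \<circ> inv_into U c has_derivative frechet_derivative (f \<circ> inv_into U c) (at (c q))) (at (c q))"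
proof -
  obtain W where W: "open W" "q \<in> W" "smooth_on (c ` (U \<inter> W)) (f \<circ> inv_into U c)"
    using f c unfolding smooth_near_def by blast
  then have "(f \<circ> inv_into U c) differentiable (at (c q))"
    using smooth_on_differentiable q by blast
  then show ?thesis by (simp add: frechet_derivative_works)
qed

lemma coordinate_field_tangent:
  assumes c: "(U, c) \<in> A" and q: "q \<in> U"
  shows "coordinate_field U c v q \<in> tangent_space A q"
proof -
  note d = smooth_near_has_derivative[OF c q, unfolded o_def]
  note i = chart_inv[OF c q]
  have 1: "frechet_derivative (\<lambda>x. f (inv_into U c x) + g (inv_into U c x)) (at (c q)) =
      (\<lambda>v. frechet_derivative (\<lambda>x. f (inv_into U c x)) (at (c q)) v +
       frechet_derivative (\<lambda>x. g (inv_into U c x)) (at (c q)) v)"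
    if "smooth_near A q f" "smooth_near A q g" for f g
    using frechet_derivative_at[OF has_derivative_add[OF d d]] that by simp
  have 2: "frechet_derivative (\<lambda>x. f (inv_into U c x) * g (inv_into U c x)) (at (c q)) =
      (\<lambda>v. f q * frechet_derivative (\<lambda>x. g (inv_into U c x)) (at (c q)) v +
       frechet_derivative (\<lambda>x. f (inv_into U c x)) (at (c q)) v * g q)"
    if "smooth_near A q f" "smooth_near A q g" for f g
    using frechet_derivative_at[OF has_derivative_mult[OF d d]] that by (simp add: i)
  have 3: "frechet_derivative (\<lambda>x. a * f (inv_into U c x)) (at (c q)) =
      (\<lambda>v. a * frechet_derivative (\<lambda>x. f (inv_into U c x)) (at (c q)) v)"
    if "smooth_near A q f" for f and a :: real
    using 2[OF smooth_near_const[of q a] that] by simp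
  show ?thesis
    unfolding tangent_space_def coordinate_field_def
    by (auto simp: o_def 1 2 3 smooth_near_add smooth_near_mult smooth_near_const)
qed

text \<open>In another chart \<open>d\<close> the function is the directional derivative of \<open>f\<close> in the chart \<open>c\<close>, composed
  with the transition map \<open>c \<circ> d\<^sup>-\<^sup>1\<close>; both are smooth.\<close>

lemma coordinate_field_smooth:
  assumes c: "(U, c) \<in> A" and p: "p \<in> U" and f: "smooth_near A p f"
  shows "smooth_near A p (\<lambda>q. act (coordinate_field U c v q) f)"
proof -
  obtain W where W: "open W" "p \<in> W"
    "\<And>V d. (V, d) \<in> A \<Longrightarrow> smooth_on (d ` (V \<inter> W)) (f \<circ> inv_into V d)"
    using f unfolding smooth_near_def by blast
  have near: "smooth_near A q f" if "q \<in> W" for q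
    unfolding smooth_near_def using W that by (intro exI[of _ W]) blast
  let ?D = "\<lambda>x. frechet_derivative (f \<circ> inv_into U c) (at x) v"
  have "smooth_on (d ` (V \<inter> (U \<inter> W))) ((\<lambda>q. act (coordinate_field U c v q) f) \<circ> inv_into V d)"
    if d: "(V, d) \<in> A" for V d
  proof -
    let ?S = "d ` (V \<inter> (U \<inter> W))"
    have S: "open ?S" using chart_image_open[OF d] chart_open[OF c] W by blast
    have "smooth_on ?S (\<lambda>x. ?D ((c \<circ> inv_into V d) x))"
    proof (rule smooth_on_compose[of "c ` (U \<inter> W)" ?D ?S "c \<circ> inv_into V d"])
      show "open ?S" by (rule S)
      show "smooth_on (c ` (U \<inter> W)) ?D"
        using smooth_on_derivative[OF W(3)[OF c]] .
      show "smooth_on ?S (c \<circ> inv_into V d)"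
        by (rule smooth_on_subset[OF chart_transition[OF d c]]) auto
      show "open (c ` (U \<inter> W))" using chart_image_open[OF c W(1)] .
      show "(c \<circ> inv_into V d) ` ?S \<subseteq> c ` (U \<inter> W)"
        using chart_inv[OF d] by auto
    qed
    then show ?thesis
    proof (rule smooth_on_cong[OF S, rotated])
      fix x assume "x \<in> ?S"
      then have "inv_into V d x \<in> W" using chart_inv[OF d] by auto
      then show "?D ((c \<circ> inv_into V d) x) =
          ((\<lambda>q. act (coordinate_field U c v q) f) \<circ> inv_into V d) x"
        using near by (simp add: coordinate_field_def)
    qed
  qed
  then show ?thesis
    unfolding smooth_near_def using W p chart_open[OF c] by (intro exI[of _ "U \<inter> W"]) auto
qed

lemma coordinate_field_vector_field:
  assumes c: "(U, c) \<in> A" and p: "p \<in> U"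
  shows "vector_field_near A p (coordinate_field U c v)"
  unfolding vector_field_near_def
  using coordinate_field_tangent[OF c] coordinate_field_smooth[OF c p] chart_open[OF c] p
  by (auto simp: eventually_nhds)

lemma coordinate_field_coordinate:
  assumes c: "(U, c) \<in> A" and p: "p \<in> U"
  shows "act (coordinate_field U c v p) (\<lambda>q. c q \<bullet> b) = v \<bullet> b"
proof -
  have "((\<lambda>x. x \<bullet> b) has_derivative (\<lambda>v. v \<bullet> b)) (at (c p))"
    by (rule bounded_linear_imp_has_derivative[OF bounded_linear_inner_left])
  moreover have "x \<bullet> b = ((\<lambda>q. c q \<bullet> b) \<circ> inv_into U c) x" if "x \<in> c ` U" for x
    using that chart_inv[OF c] by auto
  moreover have "open (c ` U)" using chart_image_open[OF c open_UNIV] by simp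
  ultimately have "((\<lambda>q. c q \<bullet> b) \<circ> inv_into U c has_derivative (\<lambda>v. v \<bullet> b)) (at (c p))"
    using p by (auto intro: has_derivative_transform_within_open)
  note d = frechet_derivative_at[OF this]
  show ?thesis
    unfolding coordinate_field_def act_Functional d[symmetric]
    using smooth_near_coordinate[OF c p] by simp
qed

text \<open>The coordinate derivations in a chart are linearly independent, as the coordinate functions
  separate them. There are as many of them as a basis of the tangent space has elements, so they span,
  and every tangent vector is the value of a coordinate field with constant coefficients.\<close>

lemma tangent_vector_extends:
  assumes y: "y \<in> tangent_space A p" and e: "basis_seq (tangent_space A p) DIM('e) e"
  obtains Y where "vector_field_near A p Y" "Y p = y"
proof -
  obtain U c where c: "(U, c) \<in> A" and p: "p \<in> U" using chart_cover by blast
  let ?L = "\<lambda>v. coordinate_field U c v p"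
  have lin: "linear ?L"
  proof (rule linearI; rule functional_eqI)
    note l = has_derivative_linear[OF smooth_near_has_derivative[OF c p]]
    show "act (?L (v + w)) f = act (?L v + ?L w) f" for v w f
      using l[of f] by (auto simp: coordinate_field_def linear_add)
    show "act (?L (a *\<^sub>R v)) f = act (a *\<^sub>R ?L v) f" for a v f
      using l[of f] by (auto simp: coordinate_field_def linear_cmul)
  qed
  have inj: "inj ?L"
  proof (rule injI)
    fix v w assume "?L v = ?L w"
    then have "v \<bullet> b = w \<bullet> b" for b using coordinate_field_coordinate[OF c p] by metis
    then show "v = w" using euclidean_eq_iff[of v w] by blast
  qed
  have "independent (?L ` Basis)"
    using linear_independent_injective_image[OF lin independent_Basis] inj
    by (simp add: inj_on_subset)
  moreover have "card (?L ` Basis) = DIM('e)"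
    using inj by (simp add: card_image inj_on_subset)
  moreover have "y \<in> span (?L ` Basis)"
  proof (rule ccontr)
    assume "y \<notin> span (?L ` Basis)"
    then have "independent (insert y (?L ` Basis))" and n: "y \<notin> ?L ` Basis"
      using calculation(1) by (auto simp: independent_insert intro: span_base)
    moreover have "insert y (?L ` Basis) \<subseteq> span (e ` {..<DIM('e)})"
      using y e coordinate_field_tangent[OF c p] unfolding basis_seq_def by auto
    ultimately have "card (insert y (?L ` Basis)) \<le> card (e ` {..<DIM('e)})"
      using independent_span_bound by blast
    also have "\<dots> \<le> DIM('e)" using card_image_le[of "{..<DIM('e)}" e] by simp
    finally show False using n \<open>card (?L ` Basis) = DIM('e)\<close> by simp
  qed
  ultimately have "y \<in> range ?L"
    using linear_span_image[OF lin, of Basis] by simp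
  then obtain v where "?L v = y" by auto
  then show ?thesis using that coordinate_field_vector_field[OF c p] by blast
qed

text \<open>The difference of the two fields vanishes near \<open>p\<close>, hence equals its product with a cutoff
  function \<open>\<rho>\<close>, and the product rule at \<open>p\<close> has two vanishing terms.\<close>

lemma connection_cong:
  assumes D: "affine_connection A D" and x: "x \<in> tangent_space A p" and Y: "vector_field_near A p Y"
    and eq: "\<forall>\<^sub>F q in nhds p. Y q = Z q"
  shows "D p x Y = D p x Z"
proof -
  let ?W = "\<lambda>q. Z q - Y q"
  have W: "vector_field_near A p ?W"
    by (intro vector_field_near_diff vector_field_near_cong[OF Y eq] Y)
  obtain \<rho> where \<rho>: "smooth_near A p \<rho>" "\<rho> p = 0" "\<And>q. Y q \<noteq> Z q \<Longrightarrow> \<rho> q = 1"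
    using cutoff[OF eq] by blast
  have "?W p = 0" using eventually_nhds_x_imp_x[OF eq] by simp
  moreover have "(\<lambda>q. \<rho> q *\<^sub>R ?W q) = ?W"
  proof
    show "\<rho> q *\<^sub>R ?W q = ?W q" for q using \<rho>(3)[of q] by (cases "Y q = Z q") simp_all
  qed
  moreover have "D p x (\<lambda>q. \<rho> q *\<^sub>R ?W q) = act x \<rho> *\<^sub>R ?W p + \<rho> p *\<^sub>R D p x ?W"
    using D x \<rho>(1) W unfolding affine_connection_def by blast
  ultimately have "D p x ?W = 0" using \<rho>(2) by simp
  moreover have "D p x (\<lambda>q. Y q + ?W q) = D p x Y + D p x ?W"
    using D x Y W unfolding affine_connection_def by blast
  ultimately show ?thesis by simp
qed

end

section \<open>Linear algebra of a single tangent space\<close>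

lemma linear_map_on_simps:
  assumes L: "linear_map_on V L" and V: "subspace V"
  shows linear_map_on_add: "x \<in> V \<Longrightarrow> y \<in> V \<Longrightarrow> L (x + y) = L x + L y"
    and linear_map_on_diff: "x \<in> V \<Longrightarrow> y \<in> V \<Longrightarrow> L (x - y) = L x - L y"
    and linear_map_on_scale: "x \<in> V \<Longrightarrow> L (a *\<^sub>R x) = a *\<^sub>R L x"
    and linear_map_on_minus: "x \<in> V \<Longrightarrow> L (- x) = - L x"
    and linear_map_on_zero: "L 0 = 0"
proof -
  have *: "L (a *\<^sub>R x + b *\<^sub>R y) = a *\<^sub>R L x + b *\<^sub>R L y" if "x \<in> V" "y \<in> V" for a b x y
    using L that unfolding linear_map_on_def by blast
  show "L (x + y) = L x + L y" "L (x - y) = L x - L y" if "x \<in> V" "y \<in> V"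
    using *[OF that, of 1 1] *[OF that, of 1 "-1"] by simp_all
  show "L (a *\<^sub>R x) = a *\<^sub>R L x" "L (- x) = - L x" if "x \<in> V"
    using *[OF that that, of a 0] *[OF that that, of "-1" 0] by simp_all
  show "L 0 = 0" using *[OF subspace_0[OF V] subspace_0[OF V], of 0 0] by simp
qed

lemma linear_map_on_sum:
  assumes L: "linear_map_on V L" and V: "subspace V" and I: "finite I" and x: "\<And>i. i \<in> I \<Longrightarrow> x i \<in> V"
  shows "L (\<Sum>i\<in>I. c i *\<^sub>R x i) = (\<Sum>i\<in>I. c i *\<^sub>R L (x i))"
  using I x
proof (induction I rule: finite_induct)
  case empty
  show ?case using linear_map_on_zero[OF L V] by simp
next
  case (insert i I)
  then have "c i *\<^sub>R x i \<in> V" "(\<Sum>i\<in>I. c i *\<^sub>R x i) \<in> V"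
    by (simp_all add: V subspace_scale subspace_sum)
  then show ?case
    using insert linear_map_on_add[OF L V] linear_map_on_scale[OF L V, of "x i"] by simp
qed

lemma basis_seq_coordinates:
  assumes e: "basis_seq V m e"
  obtains f where "\<And>i. linear_map_on V (f i)" "\<And>x. x \<in> V \<Longrightarrow> (\<Sum>i<m. f i x *\<^sub>R e i) = x"
    "\<And>i j. i < m \<Longrightarrow> j < m \<Longrightarrow> f i (e j) = (if i = j then 1 else 0)"
proof -
  let ?B = "e ` {..<m}"
  have inj: "inj_on e {..<m}" and ind: "independent ?B" and V: "V = span ?B"
    using e unfolding basis_seq_def by auto
  let ?f = "\<lambda>i x. representation ?B x (e i)"
  have "linear_map_on V (?f i)" for i
    unfolding linear_map_on_def V
    by (simp add: representation_add representation_scale ind span_scale)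
  moreover have "(\<Sum>i<m. ?f i x *\<^sub>R e i) = x" if "x \<in> V" for x
  proof -
    have "(\<Sum>b\<in>?B. representation ?B x b *\<^sub>R b) = x"
      using ind that V by (intro sum_representation_eq) auto
    then show ?thesis by (simp add: sum.reindex[OF inj])
  qed
  moreover have "?f i (e j) = (if i = j then 1 else 0)" if "i < m" "j < m" for i j
    using representation_basis[OF ind, of "e j"] that inj
    by (auto simp: inj_on_def)
  ultimately show ?thesis by (rule that)
qed

definition bilinear_on :: "'v::real_vector set \<Rightarrow> ('v \<Rightarrow> 'v \<Rightarrow> real) \<Rightarrow> bool" where
  "bilinear_on V B \<longleftrightarrow>
     (\<forall>y\<in>V. linear_map_on V (\<lambda>x. B x y)) \<and> (\<forall>x\<in>V. linear_map_on V (B x))"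

lemma metric_contraction_linear:
  "metric_contraction V g (\<lambda>x y. a * B x y + b * C x y) =
     a * metric_contraction V g B + b * metric_contraction V g C"
  unfolding metric_contraction_def Let_def
  by (simp add: algebra_simps sum.distrib sum_distrib_left)

text \<open>The algebraic structure that an almost contact B-metric manifold induces on one tangent space.\<close>

locale almost_contact_B_metric_space =
  fixes V :: "'v::real_vector set" and n :: nat and \<phi> :: "'v \<Rightarrow> 'v" and \<xi> :: 'v
    and \<eta> :: "'v \<Rightarrow> real" and g :: "'v \<Rightarrow> 'v \<Rightarrow> real"
  assumes V: "subspace V"
    and phi_linear: "linear_map_on V \<phi>" and phi_in: "x \<in> V \<Longrightarrow> \<phi> x \<in> V"
    and xi_in: "\<xi> \<in> V" and eta_linear: "linear_map_on V \<eta>"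
    and g_linear: "x \<in> V \<Longrightarrow> linear_map_on V (g x)"
    and g_sym: "x \<in> V \<Longrightarrow> y \<in> V \<Longrightarrow> g x y = g y x"
    and orthonormal_basis: "\<exists>e. basis_seq V (2 * n + 1) e \<and> (\<forall>i<2*n+1. \<forall>j<2*n+1.
           g (e i) (e j) = (if i \<noteq> j then 0 else if i < n + 1 then 1 else - 1))"
    and phi_xi: "\<phi> \<xi> = 0" and eta_xi: "\<eta> \<xi> = 1"
    and phi_phi: "x \<in> V \<Longrightarrow> \<phi> (\<phi> x) = - x + \<eta> x *\<^sub>R \<xi>"
    and eta_phi: "x \<in> V \<Longrightarrow> \<eta> (\<phi> x) = 0"
    and g_phi: "x \<in> V \<Longrightarrow> y \<in> V \<Longrightarrow> g (\<phi> x) (\<phi> y) = - g x y + \<eta> x * \<eta> y"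
begin

lemmas V_closed = phi_in xi_in subspace_0[OF V] subspace_add[OF V] subspace_diff[OF V]
  subspace_scale[OF V] subspace_neg[OF V]

lemma g_linear_left: "y \<in> V \<Longrightarrow> linear_map_on V (\<lambda>x. g x y)"
  using g_linear g_sym unfolding linear_map_on_def by (metis V_closed(4,6))

lemmas phi_simps = linear_map_on_simps[OF phi_linear V]
lemmas eta_simps = linear_map_on_simps[OF eta_linear V]
lemmas g_simps = linear_map_on_simps[OF g_linear V] linear_map_on_simps[OF g_linear_left V]

lemma g_xi: assumes x: "x \<in> V" shows "g x \<xi> = \<eta> x"
proof -
  have "g (\<phi> x) (\<phi> \<xi>) = 0"
    using linear_map_on_zero[OF g_linear[OF phi_in[OF x]] V] by (simp add: phi_xi)
  then show ?thesis using g_phi[OF x xi_in] by (simp add: eta_xi)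
qed

lemma g_xi_left: "x \<in> V \<Longrightarrow> g \<xi> x = \<eta> x"
  using g_xi g_sym xi_in by metis

text \<open>Inserting \<open>\<phi>y\<close> for \<open>y\<close> in the compatibility of \<open>g\<close> with \<open>\<phi>\<close> shows that \<open>\<phi>\<close> is self-adjoint.\<close>

lemma g_phi_swap: assumes x: "x \<in> V" and y: "y \<in> V" shows "g (\<phi> x) y = g x (\<phi> y)"
proof -
  have "g (\<phi> x) (\<phi> (\<phi> y)) = - g (\<phi> x) y"
    unfolding phi_phi[OF y] using x y
    by (simp add: g_simps V_closed g_xi eta_phi)
  moreover have "g (\<phi> x) (\<phi> (\<phi> y)) = - g x (\<phi> y)"
    using g_phi[OF x phi_in[OF y]] eta_phi[OF y] by simp
  ultimately show ?thesis by simp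
qed

text \<open>The Riesz representation: in an orthonormal basis \<open>u\<close> with signs \<open>\<epsilon>\<^sub>i = g(u\<^sub>i,u\<^sub>i)\<close> the vector is
  \<open>\<Sum>\<^sub>i \<epsilon>\<^sub>i f(u\<^sub>i) u\<^sub>i\<close>.\<close>

lemma g_functional_representation:
  assumes f: "linear_map_on V f"
  obtains d where "d \<in> V" "\<And>y. y \<in> V \<Longrightarrow> g d y = (f y :: real)"
proof -
  let ?m = "2 * n + 1"
  obtain u where u: "basis_seq V ?m u"
    and uu: "\<And>i j. i < ?m \<Longrightarrow> j < ?m \<Longrightarrow>
      g (u i) (u j) = (if i \<noteq> j then 0 else if i < n + 1 then 1 else - 1)"
    using orthonormal_basis by blast
  have uV: "u i \<in> V" if "i < ?m" for i
    using u that unfolding basis_seq_def by (auto intro: span_base)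
  obtain h where h: "\<And>x. x \<in> V \<Longrightarrow> (\<Sum>i<?m. h i x *\<^sub>R u i) = x"
    using basis_seq_coordinates[OF u] by metis
  define d where "d = (\<Sum>i<?m. (g (u i) (u i) * f (u i)) *\<^sub>R u i)"
  have d: "d \<in> V" unfolding d_def using uV by (intro subspace_sum[OF V] V_closed) auto
  have gu: "g (u i) y = g (u i) (u i) * h i y" if i: "i < ?m" and y: "y \<in> V" for i y
  proof -
    have "g (u i) y = g (u i) (\<Sum>j<?m. h j y *\<^sub>R u j)" using h[OF y] by simp
    also have "\<dots> = (\<Sum>j<?m. h j y *\<^sub>R g (u i) (u j))"
      by (rule linear_map_on_sum[OF g_linear[OF uV[OF i]] V]) (use uV in auto)
    also have "\<dots> = (\<Sum>j<?m. if j = i then h i y *\<^sub>R g (u i) (u i) else 0)"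
      using i uu by (intro sum.cong) auto
    finally show ?thesis using i by simp
  qed
  have "g d y = f y" if y: "y \<in> V" for y
  proof -
    have "g d y = (\<Sum>i<?m. (g (u i) (u i) * f (u i)) *\<^sub>R g (u i) y)"
      unfolding d_def by (rule linear_map_on_sum[OF g_linear_left[OF y] V]) (use uV in auto)
    also have "\<dots> = (\<Sum>i<?m. h i y *\<^sub>R f (u i))"
      using y uu by (intro sum.cong) (auto simp: gu)
    also have "\<dots> = f (\<Sum>i<?m. h i y *\<^sub>R u i)"
      by (rule linear_map_on_sum[OF f V, symmetric]) (use uV in auto)
    finally show ?thesis using h[OF y] by simp
  qed
  then show ?thesis using that d by blast
qed

lemma nondegenerate:
  assumes x: "x \<in> V" and "\<And>y. y \<in> V \<Longrightarrow> g x y = 0"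
  shows "x = 0"
proof -
  obtain u where u: "basis_seq V (2 * n + 1) u" using orthonormal_basis by blast
  obtain f where f: "\<And>i. linear_map_on V (f i)" "(\<Sum>i<2*n+1. f i x *\<^sub>R u i) = x"
    using basis_seq_coordinates[OF u] x by metis
  have "f i x = 0" for i
  proof -
    obtain d where d: "d \<in> V" "\<And>y. y \<in> V \<Longrightarrow> g d y = f i y"
      using g_functional_representation[OF f(1)] by blast
    then show ?thesis using assms(2)[OF d(1)] d(2)[OF x] g_sym[OF x d(1)] by simp
  qed
  then show ?thesis using f(2) by simp
qed

lemma dim_V: "dim V = 2 * n + 1"
proof -
  obtain u where "basis_seq V (2 * n + 1) u" using orthonormal_basis by blast
  then show ?thesis unfolding basis_seq_def
    using dim_span_eq_card_independent[of "u ` {..<2*n+1}"] by (auto simp: card_image)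
qed

text \<open>The contraction is defined through an unspecified basis and an unspecified inverse of its Gram
  matrix. The inverse exists because the coordinate functionals of the basis are represented by \<open>g\<close>.
  Its rows are the coefficients of the dual basis \<open>d\<close>, and in terms of \<open>e\<close> and \<open>d\<close> the contraction is
  a trace.\<close>

lemma metric_contraction_dual_bases:
  obtains e d where "\<And>i. i < 2 * n + 1 \<Longrightarrow> e i \<in> V" "\<And>i. i < 2 * n + 1 \<Longrightarrow> d i \<in> V"
    "\<And>i. i < 2 * n + 1 \<Longrightarrow> g (d i) (e i) = 1"
    "\<And>x. x \<in> V \<Longrightarrow> (\<Sum>i<2*n+1. g (d i) x *\<^sub>R e i) = x"
    "\<And>B. bilinear_on V B \<Longrightarrow> metric_contraction V g B = (\<Sum>i<2*n+1. B (e i) (d i))"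
proof -
  let ?m = "2 * n + 1"
  define e where "e = (SOME e. basis_seq V ?m e)"
  let ?inverse = "\<lambda>G :: nat \<Rightarrow> nat \<Rightarrow> real. \<forall>i<?m. \<forall>j<?m.
    (\<Sum>k<?m. G i k * g (e k) (e j)) = (if i = j then 1 else 0)"
  define G where "G = (SOME G. ?inverse G)"
  define d where "d i = (\<Sum>j<?m. G i j *\<^sub>R e j)" for i
  have e: "basis_seq V ?m e"
  proof -
    have "\<exists>e. basis_seq V ?m e" using orthonormal_basis by blast
    then show ?thesis unfolding e_def by (rule someI_ex)
  qed
  have eV: "e i \<in> V" if "i < ?m" for i
    using e that unfolding basis_seq_def by (auto intro: span_base)
  obtain f where f: "\<And>i. linear_map_on V (f i)"
    "\<And>x. x \<in> V \<Longrightarrow> (\<Sum>i<?m. f i x *\<^sub>R e i) = x"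
    "\<And>i j. i < ?m \<Longrightarrow> j < ?m \<Longrightarrow> f i (e j) = (if i = j then 1 else 0)"
    using basis_seq_coordinates[OF e] by blast
  have "\<forall>i. \<exists>c. c \<in> V \<and> (\<forall>y\<in>V. g c y = f i y)"
  proof
    fix i
    obtain c where "c \<in> V" "\<And>y. y \<in> V \<Longrightarrow> g c y = f i y"
      using g_functional_representation[OF f(1)[of i]] by blast
    then show "\<exists>c. c \<in> V \<and> (\<forall>y\<in>V. g c y = f i y)" by blast
  qed
  from choice[OF this] obtain c where c: "\<And>i. c i \<in> V" "\<And>i y. y \<in> V \<Longrightarrow> g (c i) y = f i y" by blast
  have "?inverse (\<lambda>i k. f k (c i))"
  proof (intro allI impI)
    fix i j assume ij: "i < ?m" "j < ?m"
    have "(\<Sum>k<?m. f k (c i) *\<^sub>R g (e k) (e j)) = g (\<Sum>k<?m. f k (c i) *\<^sub>R e k) (e j)"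
      by (rule linear_map_on_sum[OF g_linear_left[OF eV[OF ij(2)]] V, symmetric]) (use eV in auto)
    then show "(\<Sum>k<?m. f k (c i) * g (e k) (e j)) = (if i = j then 1 else 0)"
      using f(2)[OF c(1)] c(2)[OF eV] f(3) ij by simp
  qed
  then have G: "?inverse G" unfolding G_def by (rule someI[of ?inverse])
  have dV: "d i \<in> V" for i
    unfolding d_def using eV by (intro subspace_sum[OF V] V_closed) auto
  have de: "g (d i) (e j) = (if i = j then 1 else 0)" if ij: "i < ?m" "j < ?m" for i j
  proof -
    have "g (d i) (e j) = (\<Sum>k<?m. G i k *\<^sub>R g (e k) (e j))"
      unfolding d_def by (rule linear_map_on_sum[OF g_linear_left[OF eV[OF ij(2)]] V]) (use eV in auto)
    then show ?thesis using G ij by simp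
  qed
  have dx: "g (d i) x = f i x" if i: "i < ?m" and x: "x \<in> V" for i x
  proof -
    have "g (d i) x = g (d i) (\<Sum>j<?m. f j x *\<^sub>R e j)" using f(2)[OF x] by simp
    also have "\<dots> = (\<Sum>j<?m. f j x *\<^sub>R g (d i) (e j))"
      by (rule linear_map_on_sum[OF g_linear[OF dV] V]) (use eV in auto)
    also have "\<dots> = (\<Sum>j<?m. if j = i then f i x else 0)"
      using i de by (intro sum.cong) auto
    finally show ?thesis using i by simp
  qed
  have "metric_contraction V g B = (\<Sum>i<?m. B (e i) (d i))" if B: "bilinear_on V B" for B
  proof -
    have "metric_contraction V g B = (\<Sum>i<?m. \<Sum>j<?m. G i j *\<^sub>R B (e i) (e j))"
      unfolding metric_contraction_def Let_def dim_V e_def[symmetric] G_def[symmetric] by simp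
    also have "\<dots> = (\<Sum>i<?m. B (e i) (d i))"
      unfolding d_def using B eV unfolding bilinear_on_def
      by (intro sum.cong refl linear_map_on_sum[OF _ V, symmetric]) auto
    finally show ?thesis .
  qed
  moreover have "(\<Sum>i<?m. g (d i) x *\<^sub>R e i) = x" if "x \<in> V" for x
    using f(2)[OF that] dx that by simp
  ultimately show ?thesis using that[of e d] eV dV de by simp
qed

lemma bilinear_on_simps:
  assumes "bilinear_on V B"
  shows "x \<in> V \<Longrightarrow> y \<in> V \<Longrightarrow> z \<in> V \<Longrightarrow> B (x + y) z = B x z + B y z"
    "x \<in> V \<Longrightarrow> y \<in> V \<Longrightarrow> z \<in> V \<Longrightarrow> B (x - y) z = B x z - B y z"
    "x \<in> V \<Longrightarrow> z \<in> V \<Longrightarrow> B (a *\<^sub>R x) z = a * B x z"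
    "x \<in> V \<Longrightarrow> z \<in> V \<Longrightarrow> B (- x) z = - B x z"
    "z \<in> V \<Longrightarrow> B 0 z = 0"
    "x \<in> V \<Longrightarrow> y \<in> V \<Longrightarrow> z \<in> V \<Longrightarrow> B z (x + y) = B z x + B z y"
    "x \<in> V \<Longrightarrow> y \<in> V \<Longrightarrow> z \<in> V \<Longrightarrow> B z (x - y) = B z x - B z y"
    "x \<in> V \<Longrightarrow> z \<in> V \<Longrightarrow> B z (a *\<^sub>R x) = a * B z x"
    "x \<in> V \<Longrightarrow> z \<in> V \<Longrightarrow> B z (- x) = - B z x"
    "z \<in> V \<Longrightarrow> B z 0 = 0"
  using assms linear_map_on_simps[OF _ V, of "\<lambda>x. B x z"] linear_map_on_simps[OF _ V, of "B z"]
  unfolding bilinear_on_def by simp_all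

lemma bilinear_onI:
  assumes "\<And>x y z a b. x \<in> V \<Longrightarrow> y \<in> V \<Longrightarrow> z \<in> V \<Longrightarrow>
      B (a *\<^sub>R x + b *\<^sub>R y) z = a * B x z + b * B y z"
    and "\<And>x y z a b. x \<in> V \<Longrightarrow> y \<in> V \<Longrightarrow> z \<in> V \<Longrightarrow>
      B z (a *\<^sub>R x + b *\<^sub>R y) = a * B z x + b * B z y"
  shows "bilinear_on V B"
  using assms unfolding bilinear_on_def linear_map_on_def by simp

lemma metric_contraction_cong:
  assumes "bilinear_on V B" "bilinear_on V C" "\<And>x y. x \<in> V \<Longrightarrow> y \<in> V \<Longrightarrow> B x y = C x y"
  shows "metric_contraction V g B = metric_contraction V g C"
proof -
  obtain e d where ed: "\<And>i. i < 2 * n + 1 \<Longrightarrow> e i \<in> V" "\<And>i. i < 2 * n + 1 \<Longrightarrow> d i \<in> V"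
    "\<And>i. i < 2 * n + 1 \<Longrightarrow> g (d i) (e i) = 1"
    "\<And>x. x \<in> V \<Longrightarrow> (\<Sum>i<2*n+1. g (d i) x *\<^sub>R e i) = x"
    "\<And>B. bilinear_on V B \<Longrightarrow> metric_contraction V g B = (\<Sum>i<2*n+1. B (e i) (d i))"
    by (rule metric_contraction_dual_bases) blast
  show ?thesis
    unfolding ed(5)[OF assms(1)] ed(5)[OF assms(2)] using ed(1,2) assms(3) by (intro sum.cong) auto
qed

lemma bilinear_g: "bilinear_on V g"
  unfolding bilinear_on_def using g_linear g_linear_left by blast

lemma metric_contraction_g: "metric_contraction V g g = 2 * real n + 1"
proof -
  obtain e d where ed: "\<And>i. i < 2 * n + 1 \<Longrightarrow> e i \<in> V" "\<And>i. i < 2 * n + 1 \<Longrightarrow> d i \<in> V"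
    "\<And>i. i < 2 * n + 1 \<Longrightarrow> g (d i) (e i) = 1"
    "\<And>x. x \<in> V \<Longrightarrow> (\<Sum>i<2*n+1. g (d i) x *\<^sub>R e i) = x"
    "\<And>B. bilinear_on V B \<Longrightarrow> metric_contraction V g B = (\<Sum>i<2*n+1. B (e i) (d i))"
    by (rule metric_contraction_dual_bases) blast
  have "metric_contraction V g g = (\<Sum>i<2*n+1. 1)"
    unfolding ed(5)[OF bilinear_g] by (intro sum.cong) (use ed(1-3) g_sym in auto)
  then show ?thesis by simp
qed

lemma metric_contraction_eta:
  assumes f: "linear_map_on V f"
  shows "metric_contraction V g (\<lambda>x y. f x * \<eta> y) = f \<xi>"
proof -
  obtain e d where ed: "\<And>i. i < 2 * n + 1 \<Longrightarrow> e i \<in> V" "\<And>i. i < 2 * n + 1 \<Longrightarrow> d i \<in> V"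
    "\<And>i. i < 2 * n + 1 \<Longrightarrow> g (d i) (e i) = 1"
    "\<And>x. x \<in> V \<Longrightarrow> (\<Sum>i<2*n+1. g (d i) x *\<^sub>R e i) = x"
    "\<And>B. bilinear_on V B \<Longrightarrow> metric_contraction V g B = (\<Sum>i<2*n+1. B (e i) (d i))"
    by (rule metric_contraction_dual_bases) blast
  have "bilinear_on V (\<lambda>x y. f x * \<eta> y)"
    using f eta_linear unfolding bilinear_on_def linear_map_on_def by (simp add: algebra_simps)
  then have "metric_contraction V g (\<lambda>x y. f x * \<eta> y) = (\<Sum>i<2*n+1. f (e i) * \<eta> (d i))"
    by (rule ed(5))
  also have "\<dots> = (\<Sum>i<2*n+1. g (d i) \<xi> *\<^sub>R f (e i))"
    by (intro sum.cong) (use ed(2) g_xi in auto)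
  also have "\<dots> = f (\<Sum>i<2*n+1. g (d i) \<xi> *\<^sub>R e i)"
    by (rule linear_map_on_sum[OF f V, symmetric]) (use ed(1) in auto)
  finally show ?thesis using ed(4)[OF xi_in] by simp
qed

section \<open>Tensors in the class \<open>U\<^sub>2\<close>\<close>

definition horizontal_form :: "('v \<Rightarrow> 'v \<Rightarrow> real) \<Rightarrow> bool" where
  "horizontal_form C \<longleftrightarrow> bilinear_on V C \<and> (\<forall>x\<in>V. C \<xi> x = 0 \<and> C x \<xi> = 0)"

text \<open>The trilinear form of the shape in \<^const>\<open>F6_9_form\<close> that has \<open>C\<close> as its restriction \<open>z = \<xi>\<close>.\<close>

definition lift :: "('v \<Rightarrow> 'v \<Rightarrow> real) \<Rightarrow> 'v \<Rightarrow> 'v \<Rightarrow> 'v \<Rightarrow> real" where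
  "lift C x y z = C x y * \<eta> z + C x z * \<eta> y"

lemma horizontal_bilinear: "horizontal_form C \<Longrightarrow> bilinear_on V C"
  unfolding horizontal_form_def by blast

lemma horizontal_xi:
  "horizontal_form C \<Longrightarrow> x \<in> V \<Longrightarrow> C \<xi> x = 0" "horizontal_form C \<Longrightarrow> x \<in> V \<Longrightarrow> C x \<xi> = 0"
  unfolding horizontal_form_def by blast+

lemma horizontal_phi_phi:
  assumes C: "horizontal_form C" and x: "x \<in> V" and y: "y \<in> V"
  shows "C (\<phi> (\<phi> x)) y = - C x y" "C x (\<phi> (\<phi> y)) = - C x y"
  using assms horizontal_xi[OF C]
  by (simp_all add: phi_phi bilinear_on_simps[OF horizontal_bilinear[OF C]] V_closed)

lemma horizontal_combination:
  assumes C: "horizontal_form C" and E: "horizontal_form E"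
  shows "horizontal_form (\<lambda>x y. a * C x y + b * E x y)"
  unfolding horizontal_form_def
  using bilinear_on_simps[OF horizontal_bilinear[OF C]] bilinear_on_simps[OF horizontal_bilinear[OF E]]
    horizontal_xi[OF C] horizontal_xi[OF E]
  by (auto intro!: bilinear_onI simp: V_closed algebra_simps)

lemma horizontal_transpose:
  assumes C: "horizontal_form C"
  shows "horizontal_form (\<lambda>x y. C y x)"
  using C unfolding horizontal_form_def bilinear_on_def by auto

lemma bilinear_phi_right:
  assumes C: "bilinear_on V C"
  shows "bilinear_on V (\<lambda>x y. C x (\<phi> y))"
  by (intro bilinear_onI) (simp_all add: bilinear_on_simps[OF C] phi_simps V_closed)

lemma horizontal_phi:
  assumes C: "horizontal_form C"
  shows "horizontal_form (\<lambda>x y. C (\<phi> x) (\<phi> y))"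
  unfolding horizontal_form_def
  using bilinear_on_simps[OF horizontal_bilinear[OF C]]
  by (auto intro!: bilinear_onI simp: V_closed phi_simps phi_xi)

lemma horizontal_g_phi: "horizontal_form (\<lambda>x y. g x (\<phi> y))"
  unfolding horizontal_form_def using bilinear_phi_right[OF bilinear_g]
  by (simp add: g_xi_left V_closed eta_phi phi_xi bilinear_on_simps[OF bilinear_g])

lemma horizontal_g_phi_phi: "horizontal_form (\<lambda>x y. g (\<phi> x) (\<phi> y))"
  unfolding horizontal_form_def
  by (auto intro!: bilinear_onI simp: V_closed phi_simps phi_xi bilinear_on_simps[OF bilinear_g])

lemma lift_F_like:
  assumes C: "horizontal_form C"
  shows "F_like V \<phi> \<xi> \<eta> (lift C)"
  unfolding F_like_def linear_map_on_def lift_def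
  using horizontal_xi[OF C]
  by (auto simp: bilinear_on_simps[OF horizontal_bilinear[OF C]] eta_simps eta_phi eta_xi V_closed
      algebra_simps)

lemma lift_xi: "horizontal_form C \<Longrightarrow> x \<in> V \<Longrightarrow> y \<in> V \<Longrightarrow> lift C x y \<xi> = C x y"
  unfolding lift_def by (simp add: horizontal_xi eta_xi)

lemma lift_form: "horizontal_form C \<Longrightarrow> F6_9_form V \<xi> \<eta> (lift C)"
  unfolding F6_9_form_def by (simp add: lift_xi) (simp add: lift_def)

text \<open>The second summand of the lift contributes \<open>C(\<xi>,z) = 0\<close> by contraction with \<open>\<eta>\<close>.\<close>

lemma theta_lift:
  assumes C: "horizontal_form C" and z: "z \<in> V"
  shows "theta V g (lift C) z = \<eta> z * metric_contraction V g C"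
proof -
  have "linear_map_on V (\<lambda>x. C x z)" using C z unfolding horizontal_form_def bilinear_on_def by blast
  from metric_contraction_eta[OF this] show ?thesis
    unfolding theta_def lift_def
    using metric_contraction_linear[of V g "\<eta> z" C 1 "\<lambda>x y. C x z * \<eta> y"] horizontal_xi[OF C z]
    by (simp add: mult.commute)
qed

text \<open>Here the second summand vanishes because \<open>\<eta> \<circ> \<phi> = 0\<close>.\<close>

lemma theta_star_lift:
  assumes C: "horizontal_form C" and z: "z \<in> V"
  shows "theta_star V \<phi> g (lift C) z = \<eta> z * metric_contraction V g (\<lambda>x y. C x (\<phi> y))"
proof -
  note b = horizontal_bilinear[OF C]
  have "theta_star V \<phi> g (lift C) z =
      metric_contraction V g (\<lambda>x y. \<eta> z * C x (\<phi> y) + 0 * C x (\<phi> y))"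
    unfolding theta_star_def lift_def
    using bilinear_on_simps[OF b] z
    by (intro metric_contraction_cong bilinear_onI)
       (simp_all add: phi_simps eta_simps V_closed eta_phi algebra_simps)
  then show ?thesis using metric_contraction_linear[of V g "\<eta> z" "\<lambda>x y. C x (\<phi> y)" 0 "\<lambda>x y. C x (\<phi> y)"]
    by simp
qed

text \<open>The horizontal space has dimension \<open>2n\<close>, and \<open>g(\<phi>x,\<phi>y)\<close> is \<open>-g\<close> on it.\<close>

lemma contraction_g_phi_phi: "metric_contraction V g (\<lambda>x y. g (\<phi> x) (\<phi> y)) = - 2 * real n"
proof -
  have "metric_contraction V g (\<lambda>x y. g (\<phi> x) (\<phi> y)) =
      metric_contraction V g (\<lambda>x y. (- 1) * g x y + 1 * (\<eta> x * \<eta> y))"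
    by (intro metric_contraction_cong bilinear_onI)
       (simp_all add: V_closed phi_simps bilinear_on_simps[OF bilinear_g] eta_simps g_phi algebra_simps)
  then show ?thesis
    using metric_contraction_linear[of V g "-1" g 1 "\<lambda>x y. \<eta> x * \<eta> y"]
      metric_contraction_g metric_contraction_eta[OF eta_linear] eta_xi by simp
qed

lemma contraction_g_phi_phi_right: "metric_contraction V g (\<lambda>x y. g x (\<phi> (\<phi> y))) = - 2 * real n"
proof -
  have "metric_contraction V g (\<lambda>x y. g x (\<phi> (\<phi> y))) =
      metric_contraction V g (\<lambda>x y. g (\<phi> x) (\<phi> y))"
    by (intro metric_contraction_cong bilinear_phi_right bilinear_g
        horizontal_bilinear[OF horizontal_g_phi_phi]) (simp add: g_phi_swap phi_in)
  then show ?thesis using contraction_g_phi_phi by simp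
qed

text \<open>For \<open>n = 0\<close> the whole space is spanned by \<open>\<xi>\<close>.\<close>

lemma horizontal_form_trivial:
  assumes n: "n = 0" and C: "horizontal_form C" and x: "x \<in> V" and y: "y \<in> V"
  shows "C x y = 0"
proof -
  obtain u where "basis_seq V (2 * n + 1) u" using orthonormal_basis by blast
  then have u: "V = span {u 0}" using n by (simp add: basis_seq_def lessThan_Suc)
  obtain c d where c: "\<xi> = c *\<^sub>R u 0" and d: "x = d *\<^sub>R u 0"
    using xi_in x unfolding u span_singleton by blast
  have "c \<noteq> 0" using c eta_xi eta_simps(5) by auto
  then have "x = (d / c) *\<^sub>R \<xi>" using c d by simp
  then have "C x y = (d / c) * C \<xi> y"
    using bilinear_on_simps(3)[OF horizontal_bilinear[OF C] xi_in y] by simp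
  then show ?thesis using horizontal_xi[OF C y] by simp
qed

text \<open>For signs \<open>s\<close> and \<open>t\<close> this is the projection to the forms that are multiplied by \<open>s\<close> when the
  arguments are exchanged and by \<open>t\<close> when \<open>\<phi>\<close> is applied to both. On horizontal forms both operations
  are commuting involutions.\<close>

definition symmetry_part :: "real \<Rightarrow> real \<Rightarrow> ('v \<Rightarrow> 'v \<Rightarrow> real) \<Rightarrow> 'v \<Rightarrow> 'v \<Rightarrow> real" where
  "symmetry_part s t C x y = (C x y + s * C y x + t * (C (\<phi> x) (\<phi> y) + s * C (\<phi> y) (\<phi> x))) / 4"

lemma symmetry_part_horizontal:
  assumes C: "horizontal_form C"
  shows "horizontal_form (symmetry_part s t C)"
proof -
  let ?E = "\<lambda>x y. 1 * C x y + s * C y x"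
  have E: "horizontal_form ?E"
    by (rule horizontal_combination[OF C horizontal_transpose[OF C]])
  have eq: "symmetry_part s t C = (\<lambda>x y. (1/4) * ?E x y + (t/4) * ?E (\<phi> x) (\<phi> y))"
    unfolding symmetry_part_def by (simp add: fun_eq_iff field_simps)
  show ?thesis unfolding eq by (rule horizontal_combination[OF E horizontal_phi[OF E]])
qed

lemma symmetry_part_symmetry:
  assumes "s * s = 1"
  shows "symmetry_part s t C x y = s * symmetry_part s t C y x"
  using assms unfolding symmetry_part_def by (simp add: algebra_simps) (simp add: mult.assoc[symmetric])

lemma symmetry_part_phi:
  assumes C: "horizontal_form C" and t: "t * t = 1" and x: "x \<in> V" and y: "y \<in> V"
  shows "symmetry_part s t C x y = t * symmetry_part s t C (\<phi> x) (\<phi> y)"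
proof -
  have "C (\<phi> (\<phi> x)) (\<phi> (\<phi> y)) = C x y" "C (\<phi> (\<phi> y)) (\<phi> (\<phi> x)) = C y x"
    using x y by (simp_all add: horizontal_phi_phi[OF C] V_closed)
  then show ?thesis
    using t unfolding symmetry_part_def by (simp add: algebra_simps) (simp add: mult.assoc[symmetric])
qed

lemma symmetry_part_sum: "C x y = symmetry_part 1 (-1) C x y + symmetry_part (-1) (-1) C x y + symmetry_part 1 1 C x y + symmetry_part (-1) 1 C x y"
  unfolding symmetry_part_def by (simp add: field_simps)

text \<open>Membership in \<^const>\<open>F4_class\<close>, \<^const>\<open>F5_class\<close> and \<^const>\<open>F11_class\<close> does not mention this form
  explicitly. It holds because the forms \<open>g(\<phi>x,\<phi>y)\<close> and \<open>g(x,\<phi>y)\<close> vanish for \<open>y = \<xi>\<close>, and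
  because \<open>\<omega>(\<xi>) = 0\<close> for a tensor in \<^const>\<open>F11_class\<close>.\<close>

lemma U2_class_imp_form:
  assumes "T \<in> U2_class V n \<phi> \<xi> \<eta> g"
  shows "F6_9_form V \<xi> \<eta> T"
proof -
  obtain T4 T5 T6 T7 T8 T9 T11 where T:
    "T4 \<in> F4_class V n \<phi> \<xi> \<eta> g" "T5 \<in> F5_class V n \<phi> \<xi> \<eta> g" "T6 \<in> F6_class V \<phi> \<xi> \<eta> g"
    "T7 \<in> F7_class V \<phi> \<xi> \<eta>" "T8 \<in> F8_class V \<phi> \<xi> \<eta>" "T9 \<in> F9_class V \<phi> \<xi> \<eta>"
    "T11 \<in> F11_class V \<phi> \<xi> \<eta>"
    and sum: "\<And>x y z. x \<in> V \<Longrightarrow> y \<in> V \<Longrightarrow> z \<in> V \<Longrightarrow>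
       T x y z = T4 x y z + T5 x y z + T6 x y z + T7 x y z + T8 x y z + T9 x y z + T11 x y z"
    using assms unfolding U2_class_def mem_Collect_eq by blast
  note g0 = bilinear_on_simps(10)[OF bilinear_g]
  have multiple: "F6_9_form V \<xi> \<eta> T'"
    if "\<And>x y z. x \<in> V \<Longrightarrow> y \<in> V \<Longrightarrow> z \<in> V \<Longrightarrow> T' x y z = k * (H x y * \<eta> z + H x z * \<eta> y)"
      and "\<And>x. x \<in> V \<Longrightarrow> H x \<xi> = 0" for T' H k
    unfolding F6_9_form_def by (simp add: that xi_in eta_xi ring_distribs)
  have "F6_9_form V \<xi> \<eta> T4"
    by (rule multiple[of T4 "- (theta V g T4 \<xi> / (2 * real n))" "\<lambda>x y. g (\<phi> x) (\<phi> y)"])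
      (use T(1) in \<open>simp_all add: F4_class_def V_closed phi_xi g0\<close>)
  moreover have "F6_9_form V \<xi> \<eta> T5"
    by (rule multiple[of T5 "- (theta_star V \<phi> g T5 \<xi> / (2 * real n))" "\<lambda>x y. g x (\<phi> y)"])
      (use T(2) in \<open>simp_all add: F5_class_def V_closed phi_xi g0\<close>)
  moreover have "F6_9_form V \<xi> \<eta> T6" "F6_9_form V \<xi> \<eta> T7" "F6_9_form V \<xi> \<eta> T8" "F6_9_form V \<xi> \<eta> T9"
    using T(3-6) unfolding F6_class_def F7_class_def F8_class_def F9_class_def by blast+
  moreover have "F6_9_form V \<xi> \<eta> T11"
  proof -
    have eq: "T11 x y z = \<eta> x * (\<eta> y * omega \<xi> T11 z + \<eta> z * omega \<xi> T11 y)"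
      if "x \<in> V" "y \<in> V" "z \<in> V" for x y z
      using T(7) that unfolding F11_class_def by blast
    have "omega \<xi> T11 \<xi> = 0"
      using eq[OF xi_in xi_in xi_in] by (simp add: eta_xi omega_def)
    then show ?thesis unfolding F6_9_form_def by (simp add: eq xi_in eta_xi algebra_simps)
  qed
  ultimately have forms: "\<forall>T'\<in>{T4, T5, T6, T7, T8, T9, T11}. F6_9_form V \<xi> \<eta> T'"
    by blast
  show ?thesis
    unfolding F6_9_form_def
  proof (intro ballI)
    fix x y z assume x: "x \<in> V" and y: "y \<in> V" and z: "z \<in> V"
    have form: "T' x y z = T' x y \<xi> * \<eta> z + T' x z \<xi> * \<eta> y"
      if "T' \<in> {T4, T5, T6, T7, T8, T9, T11}" for T'
      using forms[rule_format, OF that] x y z unfolding F6_9_form_def by blast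
    show "T x y z = T x y \<xi> * \<eta> z + T x z \<xi> * \<eta> y"
      unfolding sum[OF x y z] sum[OF x y xi_in] sum[OF x z xi_in]
        form[of T4, simplified] form[of T5, simplified] form[of T6, simplified]
        form[of T7, simplified] form[of T8, simplified] form[of T9, simplified]
        form[of T11, simplified]
      by (simp add: algebra_simps)
  qed
qed

text \<open>After the splitting by symmetry types the point is to choose the multiples \<open>a\<close> of \<open>g(\<phi>x,\<phi>y)\<close> and
  \<open>b\<close> of \<open>g(x,\<phi>y)\<close> whose removal from the symmetric, \<open>\<phi>\<close>-anti-invariant part \<open>S\<close> makes both traces
  vanish. This is a system of two linear equations. With \<open>\<tau>\<close> the trace of \<open>\<phi>\<close> its determinant is
  \<open>4 n\<^sup>2 + \<tau>\<^sup>2\<close>, which is positive for \<open>n > 0\<close>; for \<open>n = 0\<close> all horizontal forms vanish.\<close>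

lemma form_imp_U2_class:
  assumes F: "F_like V \<phi> \<xi> \<eta> T" and form: "F6_9_form V \<xi> \<eta> T"
  shows "T \<in> U2_class V n \<phi> \<xi> \<eta> g"
proof -
  have T_lin: "linear_map_on V (\<lambda>x. T x y z)" "linear_map_on V (\<lambda>y. T x y z)"
    if "x \<in> V" "y \<in> V" "z \<in> V" for x y z
    using F that unfolding F_like_def by blast+
  have T_form: "T x y z = T x y \<xi> * \<eta> z + T x z \<xi> * \<eta> y" if "x \<in> V" "y \<in> V" "z \<in> V" for x y z
    using form that unfolding F6_9_form_def by blast
  have T_xi_xi: "T x \<xi> \<xi> = 0" if "x \<in> V" for x
    using T_form[OF that xi_in xi_in] by (simp add: eta_xi)
  have B: "bilinear_on V (\<lambda>x y. T x y \<xi>)"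
    unfolding bilinear_on_def using T_lin xi_in by blast
  note B_simps = bilinear_on_simps[OF B]

  define \<omega> where "\<omega> = (\<lambda>y. T \<xi> y \<xi>)"
  define C where "C = (\<lambda>x y. T x y \<xi> - \<eta> x * \<omega> y)"
  have C: "horizontal_form C"
    unfolding horizontal_form_def C_def \<omega>_def
    by (auto intro!: bilinear_onI simp: B_simps eta_simps V_closed eta_xi T_xi_xi algebra_simps)

  \<comment> \<open>The part of \<open>C\<close> that is divided between \<^const>\<open>F4_class\<close>, \<^const>\<open>F5_class\<close> and \<^const>\<open>F6_class\<close>.\<close>
  define S where "S = symmetry_part 1 (-1) C"
  have S: "horizontal_form S" unfolding S_def by (rule symmetry_part_horizontal[OF C])
  have S_sym: "S x y = S y x" for x y
    unfolding S_def by (subst symmetry_part_symmetry) simp_all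
  have S_phi: "S x y = - S (\<phi> x) (\<phi> y)" if "x \<in> V" "y \<in> V" for x y
    using symmetry_part_phi[OF C _ that, of "-1" 1] unfolding S_def by simp
  let ?P = "\<lambda>x y. g (\<phi> x) (\<phi> y)" and ?Q = "\<lambda>x y. g x (\<phi> y)"
  define s where "s = metric_contraction V g S"
  define s' where "s' = metric_contraction V g (\<lambda>x y. S x (\<phi> y))"
  define \<tau> where "\<tau> = metric_contraction V g ?Q"
  define \<Delta> where "\<Delta> = (2 * real n) * (2 * real n) + \<tau> * \<tau>"
  \<comment> \<open>Cramer's rule for the two trace equations \<open>solve\<close>. If \<open>n = 0\<close>, both numerators are zero.\<close>
  define a where "a = - (2 * real n * s + \<tau> * s') / \<Delta>"
  define b where "b = (\<tau> * s - 2 * real n * s') / \<Delta>"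
  have s_trivial: "s = 0" "s' = 0" if "n = 0"
  proof -
    have zero: "metric_contraction V g (\<lambda>x y. 0) = 0"
      using metric_contraction_linear[of V g 0 g 0 g] by simp
    have b0: "bilinear_on V (\<lambda>x y. 0)" by (intro bilinear_onI) simp_all
    show "s = 0" unfolding s_def
      using metric_contraction_cong[OF horizontal_bilinear[OF S] b0] horizontal_form_trivial[OF that S]
      zero by simp
    show "s' = 0" unfolding s'_def
      using metric_contraction_cong[OF bilinear_phi_right[OF horizontal_bilinear[OF S]] b0]
        horizontal_form_trivial[OF that S] phi_in zero by simp
  qed
  have solve: "s + 2 * real n * a - \<tau> * b = 0" "s' + \<tau> * a + 2 * real n * b = 0"
    and ab_trivial: "n = 0 \<Longrightarrow> a = 0" "n = 0 \<Longrightarrow> b = 0"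
  proof -
    show "n = 0 \<Longrightarrow> a = 0" "n = 0 \<Longrightarrow> b = 0" using s_trivial by (simp_all add: a_def b_def)
    have "s + 2 * real n * a - \<tau> * b = 0 \<and> s' + \<tau> * a + 2 * real n * b = 0"
    proof (cases "n = 0")
      case True
      then show ?thesis using s_trivial by (simp add: a_def b_def)
    next
      case False
      \<comment> \<open>A sum of two real squares, the first of which is not zero.\<close>
      then have "\<Delta> \<noteq> 0" unfolding \<Delta>_def using sum_squares_eq_zero_iff[of "2 * real n" \<tau>] by simp
      then have "a * \<Delta> = - (2 * real n * s + \<tau> * s')" "b * \<Delta> = \<tau> * s - 2 * real n * s'"
        by (simp_all add: a_def b_def)
      then have "(s + 2 * real n * a - \<tau> * b) * \<Delta> = 0" "(s' + \<tau> * a + 2 * real n * b) * \<Delta> = 0"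
        unfolding \<Delta>_def by algebra+
      then show ?thesis using \<open>\<Delta> \<noteq> 0\<close> by simp
    qed
    then show "s + 2 * real n * a - \<tau> * b = 0" "s' + \<tau> * a + 2 * real n * b = 0" by blast+
  qed

  \<comment> \<open>The zero coefficients let one pair of trace formulas serve \<open>B4\<close>, \<open>B5\<close> and \<open>R\<close>.\<close>
  define B4 where "B4 = (\<lambda>x y. a * ?P x y + 0 * ?Q x y)"
  define B5 where "B5 = (\<lambda>x y. 0 * ?P x y + b * ?Q x y)"
  define R where "R = (\<lambda>x y. a * ?P x y + b * ?Q x y)"
  define B6 where "B6 = (\<lambda>x y. 1 * S x y + (-1) * R x y)"
  note PQ = horizontal_combination[OF horizontal_g_phi_phi horizontal_g_phi]
  have B4: "horizontal_form B4" and B5: "horizontal_form B5" and R: "horizontal_form R"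
    unfolding B4_def B5_def R_def by (rule PQ)+
  have B6: "horizontal_form B6" unfolding B6_def by (rule horizontal_combination[OF S R])
  have tr_R: "metric_contraction V g (\<lambda>x y. \<alpha> * ?P x y + \<beta> * ?Q x y) = - (2 * real n * \<alpha>) + \<beta> * \<tau>"
    for \<alpha> \<beta>
    by (simp add: metric_contraction_linear contraction_g_phi_phi \<tau>_def)
  have tr_P_phi: "metric_contraction V g (\<lambda>x y. ?P x (\<phi> y)) = - \<tau>"
  proof -
    have "metric_contraction V g (\<lambda>x y. ?P x (\<phi> y)) =
        metric_contraction V g (\<lambda>x y. (-1) * ?Q x y + 0 * ?Q x y)"
      by (intro metric_contraction_cong bilinear_phi_right horizontal_bilinear[OF horizontal_g_phi_phi]
          horizontal_bilinear[OF horizontal_combination[OF horizontal_g_phi horizontal_g_phi]])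
        (simp add: g_phi V_closed eta_phi)
    then show ?thesis unfolding metric_contraction_linear \<tau>_def by simp
  qed
  have tr_R_phi: "metric_contraction V g (\<lambda>x y. \<alpha> * ?P x (\<phi> y) + \<beta> * ?Q x (\<phi> y)) =
      - (\<tau> * \<alpha>) - 2 * real n * \<beta>" for \<alpha> \<beta>
    unfolding metric_contraction_linear[of V g \<alpha> "\<lambda>x y. ?P x (\<phi> y)" \<beta> "\<lambda>x y. ?Q x (\<phi> y)"]
      tr_P_phi contraction_g_phi_phi_right by simp

  have m4: "lift B4 \<in> F4_class V n \<phi> \<xi> \<eta> g"
  proof -
    have "theta V g (lift B4) \<xi> = - (2 * real n * a)"
      using theta_lift[OF B4 xi_in] tr_R[of a 0] by (simp add: eta_xi B4_def)
    then have k: "- (theta V g (lift B4) \<xi> / (2 * real n)) = a" using ab_trivial by (cases "n = 0") simp_all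
    have "lift B4 x y z = a * (?P x y * \<eta> z + ?P x z * \<eta> y)" for x y z
      by (simp add: lift_def B4_def algebra_simps)
    then show ?thesis
      unfolding F4_class_def mem_Collect_eq k using lift_F_like[OF B4] by blast
  qed
  have m5: "lift B5 \<in> F5_class V n \<phi> \<xi> \<eta> g"
  proof -
    have "theta_star V \<phi> g (lift B5) \<xi> = - (2 * real n * b)"
      using theta_star_lift[OF B5 xi_in] tr_R_phi[of 0 b] by (simp add: eta_xi B5_def)
    then have k: "- (theta_star V \<phi> g (lift B5) \<xi> / (2 * real n)) = b"
      using ab_trivial by (cases "n = 0") simp_all
    have "lift B5 x y z = b * (?Q x y * \<eta> z + ?Q x z * \<eta> y)" for x y z
      by (simp add: lift_def B5_def algebra_simps)
    then show ?thesis
      unfolding F5_class_def mem_Collect_eq k using lift_F_like[OF B5] by blast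
  qed
  have m6: "lift B6 \<in> F6_class V \<phi> \<xi> \<eta> g"
  proof -
    have tr: "metric_contraction V g B6 = 0"
      unfolding B6_def metric_contraction_linear
      unfolding R_def tr_R s_def[symmetric] using solve(1) by (simp add: algebra_simps)
    have tr_phi: "metric_contraction V g (\<lambda>x y. B6 x (\<phi> y)) = 0"
      unfolding B6_def
        metric_contraction_linear[of V g 1 "\<lambda>x y. S x (\<phi> y)" "-1" "\<lambda>x y. R x (\<phi> y)"]
      unfolding R_def tr_R_phi s'_def[symmetric] using solve(2) by (simp add: algebra_simps)
    have sym: "B6 x y = B6 y x" if "x \<in> V" "y \<in> V" for x y
      using that S_sym[of x y] g_sym[of "\<phi> x" "\<phi> y"] g_sym[of "\<phi> x" y]
      by (simp add: B6_def R_def V_closed g_phi_swap)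
    have anti: "B6 x y = - B6 (\<phi> x) (\<phi> y)" if "x \<in> V" "y \<in> V" for x y
      using that S_phi[of x y] horizontal_phi_phi[OF horizontal_g_phi_phi that]
        horizontal_phi_phi[OF horizontal_g_phi_phi, of "\<phi> x" "\<phi> y"]
      by (simp add: B6_def R_def V_closed g_phi eta_phi algebra_simps)
    show ?thesis
      unfolding F6_class_def
    proof (intro CollectI conjI ballI lift_F_like[OF B6] lift_form[OF B6])
      fix x y assume "x \<in> V" "y \<in> V"
      then show "lift B6 x y \<xi> = lift B6 y x \<xi>" "lift B6 x y \<xi> = - lift B6 (\<phi> x) (\<phi> y) \<xi>"
        using sym[of x y] anti[of x y] by (simp_all only: lift_xi[OF B6] phi_in)
    next
      fix z assume "z \<in> V"
      then show "theta V g (lift B6) z = 0" "theta_star V \<phi> g (lift B6) z = 0"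
        using tr tr_phi by (simp_all add: theta_lift[OF B6] theta_star_lift[OF B6])
    qed
  qed
  have part_class: "F_like V \<phi> \<xi> \<eta> (lift (symmetry_part s t C)) \<and>
      F6_9_form V \<xi> \<eta> (lift (symmetry_part s t C)) \<and>
      (\<forall>x\<in>V. \<forall>y\<in>V. lift (symmetry_part s t C) x y \<xi> = s * lift (symmetry_part s t C) y x \<xi> \<and>
        lift (symmetry_part s t C) x y \<xi> = t * lift (symmetry_part s t C) (\<phi> x) (\<phi> y) \<xi>)"
    if "s * s = 1" "t * t = 1" for s t
  proof -
    note h = symmetry_part_horizontal[OF C, of s t]
    show ?thesis
    proof (intro conjI ballI lift_F_like[OF h] lift_form[OF h])
      fix x y assume "x \<in> V" "y \<in> V"
      then show "lift (symmetry_part s t C) x y \<xi> = s * lift (symmetry_part s t C) y x \<xi>"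
        "lift (symmetry_part s t C) x y \<xi> = t * lift (symmetry_part s t C) (\<phi> x) (\<phi> y) \<xi>"
        using symmetry_part_symmetry[OF that(1), of t C x y] symmetry_part_phi[OF C that(2), of x y s]
        by (simp_all only: lift_xi[OF h] phi_in)
    qed
  qed
  have m7: "lift (symmetry_part (-1) (-1) C) \<in> F7_class V \<phi> \<xi> \<eta>"
    unfolding F7_class_def mem_Collect_eq by (rule part_class[of "-1" "-1", simplified])
  have m8: "lift (symmetry_part 1 1 C) \<in> F8_class V \<phi> \<xi> \<eta>"
    unfolding F8_class_def mem_Collect_eq by (rule part_class[of 1 1, simplified])
  have m9: "lift (symmetry_part (-1) 1 C) \<in> F9_class V \<phi> \<xi> \<eta>"
    unfolding F9_class_def mem_Collect_eq by (rule part_class[of "-1" 1, simplified])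
  have m11: "(\<lambda>x y z. \<eta> x * (\<eta> y * \<omega> z + \<eta> z * \<omega> y)) \<in> F11_class V \<phi> \<xi> \<eta>"
    (is "?T11 \<in> _")
  proof -
    have \<omega>: "\<omega> (x + y) = \<omega> x + \<omega> y" "\<omega> (c *\<^sub>R x) = c * \<omega> x" "\<omega> \<xi> = 0"
      if "x \<in> V" "y \<in> V" for x y c
      unfolding \<omega>_def using that by (simp_all add: B_simps V_closed T_xi_xi)
    then have "F_like V \<phi> \<xi> \<eta> ?T11"
      unfolding F_like_def linear_map_on_def
      using \<omega>(3)[OF xi_in xi_in]
      by (simp add: eta_simps eta_phi eta_xi V_closed algebra_simps)
    moreover have "omega \<xi> ?T11 z = \<omega> z" for z
      using \<omega>(3)[OF xi_in xi_in] by (simp add: omega_def eta_xi)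
    ultimately show ?thesis unfolding F11_class_def by simp
  qed
  have eq: "T x y z = lift B4 x y z + lift B5 x y z + lift B6 x y z +
      lift (symmetry_part (-1) (-1) C) x y z + lift (symmetry_part 1 1 C) x y z +
      lift (symmetry_part (-1) 1 C) x y z + ?T11 x y z"
    if "x \<in> V" "y \<in> V" "z \<in> V" for x y z
  proof -
    have c: "C x w = B4 x w + B5 x w + B6 x w + symmetry_part (-1) (-1) C x w +
        symmetry_part 1 1 C x w + symmetry_part (-1) 1 C x w" for w
      using symmetry_part_sum[of C x w]
      by (simp add: B4_def B5_def B6_def R_def S_def)
    have "T x y z = (C x y + \<eta> x * \<omega> y) * \<eta> z + (C x z + \<eta> x * \<omega> z) * \<eta> y"
      using T_form[OF that] by (simp add: C_def)
    then show ?thesis unfolding lift_def c[of y] c[of z] by (simp add: algebra_simps)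
  qed
  show ?thesis
    unfolding U2_class_def mem_Collect_eq
    by (rule bexI[OF _ m4], rule bexI[OF _ m5], rule bexI[OF _ m6], rule bexI[OF _ m7],
        rule bexI[OF _ m8], rule bexI[OF _ m9], rule bexI[OF _ m11], intro ballI, rule eq)
qed

end

section \<open>Covariant derivatives of the structure tensors\<close>

locale almost_contact_B_metric_manifold_connection =
  fixes A :: "('a::{t2_space,second_countable_topology}, 'e::euclidean_space) atlas"
    and n :: nat
    and \<phi> :: "'a \<Rightarrow> 'a functional \<Rightarrow> 'a functional"
    and \<xi> :: "'a \<Rightarrow> 'a functional"
    and \<eta> :: "'a \<Rightarrow> 'a functional \<Rightarrow> real"
    and g :: "'a \<Rightarrow> 'a functional \<Rightarrow> 'a functional \<Rightarrow> real"
    and D :: "'a connection"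
  assumes B_metric: "almost_contact_B_metric_manifold A n \<phi> \<xi> \<eta> g"
    and affine: "affine_connection A D" and metric: "metric_parallel A g D"
begin

sublocale manifold A
  using B_metric unfolding almost_contact_B_metric_manifold_def by unfold_locales blast

lemma phi_field: "endo_field A \<phi>" and xi_field: "vector_field A \<xi>" and eta_form: "one_form A \<eta>"
  and g_metric: "pseudo_riemannian_metric A (n + 1) n g" and dimension: "DIM('e) = 2 * n + 1"
  using B_metric unfolding almost_contact_B_metric_manifold_def by blast+

lemma structure_at:
  shows "\<phi> p (\<xi> p) = 0" "\<eta> p (\<xi> p) = 1"
    "x \<in> tangent_space A p \<Longrightarrow> \<phi> p (\<phi> p x) = - x + \<eta> p x *\<^sub>R \<xi> p"
    "x \<in> tangent_space A p \<Longrightarrow> \<eta> p (\<phi> p x) = 0"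
    "x \<in> tangent_space A p \<Longrightarrow> y \<in> tangent_space A p \<Longrightarrow>
       g p (\<phi> p x) (\<phi> p y) = - g p x y + \<eta> p x * \<eta> p y"
  using B_metric unfolding almost_contact_B_metric_manifold_def by blast+

sublocale pt: almost_contact_B_metric_space "tangent_space A p" n "\<phi> p" "\<xi> p" "\<eta> p" "g p" for p
proof
  have "\<exists>e. basis_seq (tangent_space A p) (n + 1 + n) e \<and> (\<forall>i<n+1+n. \<forall>j<n+1+n.
      g p (e i) (e j) = (if i \<noteq> j then 0 else if i < n + 1 then 1 else - 1))"
    using g_metric unfolding pseudo_riemannian_metric_def by blast
  moreover have "n + 1 + n = 2 * n + 1" by simp
  ultimately show "\<exists>e. basis_seq (tangent_space A p) (2 * n + 1) e \<and> (\<forall>i<2*n+1. \<forall>j<2*n+1.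
      g p (e i) (e j) = (if i \<noteq> j then 0 else if i < n + 1 then 1 else - 1))"
    by metis
  show "linear_map_on (tangent_space A p) (g p x)" if "x \<in> tangent_space A p" for x
    using g_metric that unfolding pseudo_riemannian_metric_def by blast
  show "g p x y = g p y x" if "x \<in> tangent_space A p" "y \<in> tangent_space A p" for x y
    using g_metric that unfolding pseudo_riemannian_metric_def by blast
  show "linear_map_on (tangent_space A p) (\<eta> p)"
    using eta_form unfolding one_form_def by blast
  show "linear_map_on (tangent_space A p) (\<phi> p)"
    using phi_field unfolding endo_field_def by blast
  show "\<phi> p x \<in> tangent_space A p" if "x \<in> tangent_space A p" for x
    using phi_field that unfolding endo_field_def by blast
  show "\<xi> p \<in> tangent_space A p"
    using xi_field vector_field_near_tangent unfolding vector_field_def by blast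
qed (fact subspace_tangent_space structure_at)+

abbreviation T where "T \<equiv> tangent_space A"
abbreviation vf where "vf \<equiv> vector_field_near A"

lemma vf_xi: "vf p \<xi>" using xi_field unfolding vector_field_def by blast

lemma vf_phi: "vf p Y \<Longrightarrow> vf p (\<lambda>q. \<phi> q (Y q))"
  using phi_field unfolding endo_field_def by blast

lemma smooth_eta: "vf p Y \<Longrightarrow> smooth_near A p (\<lambda>q. \<eta> q (Y q))"
  using eta_form unfolding one_form_def by blast

lemma vf_eta_xi: "vf p Y \<Longrightarrow> vf p (\<lambda>q. \<eta> q (Y q) *\<^sub>R \<xi> q)"
  by (intro vector_field_near_scale smooth_eta vf_xi)

lemma extension:
  assumes "y \<in> T p"
  obtains Y where "vf p Y" "Y p = y"
proof -
  obtain e where "basis_seq (T p) DIM('e) e" using pt.orthonormal_basis dimension by metis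
  then show ?thesis using tangent_vector_extends[OF assms] that by blast
qed

lemma D_in: "x \<in> T p \<Longrightarrow> vf p Y \<Longrightarrow> D p x Y \<in> T p"
  and D_linear: "vf p Y \<Longrightarrow> linear_map_on (T p) (\<lambda>x. D p x Y)"
  and D_add: "x \<in> T p \<Longrightarrow> vf p Y \<Longrightarrow> vf p Z \<Longrightarrow> D p x (\<lambda>q. Y q + Z q) = D p x Y + D p x Z"
  and D_scale: "x \<in> T p \<Longrightarrow> smooth_near A p f \<Longrightarrow> vf p Y \<Longrightarrow>
      D p x (\<lambda>q. f q *\<^sub>R Y q) = act x f *\<^sub>R Y p + f p *\<^sub>R D p x Y"
  and D_smooth: "vf p X \<Longrightarrow> vf p Y \<Longrightarrow> vf p (\<lambda>q. D q (X q) Y)"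
  using affine unfolding affine_connection_def by blast+

lemma D_diff:
  assumes x: "x \<in> T p" and Y: "vf p Y" and Z: "vf p Z"
  shows "D p x (\<lambda>q. Y q - Z q) = D p x Y - D p x Z"
proof -
  have "D p x (\<lambda>q. (-1) *\<^sub>R Z q) = - D p x Z"
    using D_scale[OF x smooth_near_const[of p "-1"] Z] tangent_const[OF x] by simp
  then show ?thesis
    using D_add[OF x Y vector_field_near_scale[OF smooth_near_const[of p "-1"] Z]] by simp
qed

lemma D_zero: "x \<in> T p \<Longrightarrow> D p x (\<lambda>q. 0) = 0"
  using D_diff[of x p \<xi> \<xi>] vf_xi by simp

lemma D_cong: "x \<in> T p \<Longrightarrow> vf p Y \<Longrightarrow> \<forall>\<^sub>F q in nhds p. Y q = Z q \<Longrightarrow> D p x Y = D p x Z"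
  by (rule connection_cong[OF affine])

lemma D_metric:
  assumes "x \<in> T p" "vf p Y" "vf p Z"
  shows "act x (\<lambda>q. g q (Y q) (Z q)) = g p (D p x Y) (Z p) + g p (Y p) (D p x Z)"
proof -
  have "cov_metric D g p x Y Z = 0"
    using metric assms unfolding metric_parallel_def by blast
  then show ?thesis unfolding cov_metric_def by simp
qed

lemma D_eta_xi:
  assumes "x \<in> T p" "vf p Y"
  shows "D p x (\<lambda>q. \<eta> q (Y q) *\<^sub>R \<xi> q) = act x (\<lambda>q. \<eta> q (Y q)) *\<^sub>R \<xi> p + \<eta> p (Y p) *\<^sub>R D p x \<xi>"
  by (rule D_scale[OF assms(1) smooth_eta[OF assms(2)] vf_xi])

text \<open>Differentiate \<open>g(\<xi>,\<xi>) = 1\<close>.\<close>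

lemma eta_D_xi:
  assumes x: "x \<in> T p"
  shows "\<eta> p (D p x \<xi>) = 0"
proof -
  have "g q (\<xi> q) (\<xi> q) = 1" for q using pt.g_xi[OF pt.xi_in] pt.eta_xi by simp
  then have "g p (D p x \<xi>) (\<xi> p) + g p (\<xi> p) (D p x \<xi>) = 0"
    using D_metric[OF x vf_xi vf_xi] tangent_const[OF x] by simp
  then show ?thesis
    using pt.g_xi[OF D_in[OF x vf_xi]] pt.g_xi_left[OF D_in[OF x vf_xi]] by simp
qed

text \<open>Differentiate \<open>\<eta>(Y) = g(Y,\<xi>)\<close>.\<close>

lemma cov_form_eq:
  assumes x: "x \<in> T p" and Y: "vf p Y"
  shows "cov_form D \<eta> p x Y = g p (Y p) (D p x \<xi>)"
proof -
  have "act x (\<lambda>q. \<eta> q (Y q)) = act x (\<lambda>q. g q (Y q) (\<xi> q))"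
    using vector_field_near_eventually[OF Y]
    by (intro act_cong[OF x]) (auto elim!: eventually_mono simp: pt.g_xi)
  then show ?thesis
    unfolding cov_form_def using D_metric[OF x Y vf_xi] pt.g_xi[OF D_in[OF x Y]] by simp
qed

abbreviation D_phi :: "'a \<Rightarrow> 'a functional \<Rightarrow> ('a \<Rightarrow> 'a functional) \<Rightarrow> 'a functional" where
  "D_phi \<equiv> cov_endo D \<phi>"

lemma D_phi_in: "x \<in> T p \<Longrightarrow> vf p Y \<Longrightarrow> D_phi p x Y \<in> T p"
  unfolding cov_endo_def by (intro pt.V_closed D_in vf_phi)

text \<open>Differentiate \<open>g(\<phi>Y,Z) = g(Y,\<phi>Z)\<close>. Although \<open>\<phi>\<close> need not be parallel, its covariant derivative
  inherits self-adjointness from it.\<close>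

lemma D_phi_symmetric:
  assumes x: "x \<in> T p" and Y: "vf p Y" and Z: "vf p Z"
  shows "g p (D_phi p x Y) (Z p) = g p (Y p) (D_phi p x Z)"
proof -
  have "\<forall>\<^sub>F q in nhds p. g q (\<phi> q (Y q)) (Z q) = g q (Y q) (\<phi> q (Z q))"
    using vector_field_near_eventually[OF Y] vector_field_near_eventually[OF Z]
    by eventually_elim (rule pt.g_phi_swap)
  from act_cong[OF x this]
  have "g p (D p x (\<lambda>q. \<phi> q (Y q))) (Z p) + g p (\<phi> p (Y p)) (D p x Z) =
      g p (D p x Y) (\<phi> p (Z p)) + g p (Y p) (D p x (\<lambda>q. \<phi> q (Z q)))"
    using D_metric[OF x vf_phi[OF Y] Z] D_metric[OF x Y vf_phi[OF Z]] by simp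
  then show ?thesis
    unfolding cov_endo_def
    using D_in[OF x Y] D_in[OF x Z] D_in[OF x vf_phi[OF Y]] D_in[OF x vf_phi[OF Z]]
      vector_field_near_tangent[OF Y] vector_field_near_tangent[OF Z]
    by (simp add: pt.g_simps pt.V_closed pt.g_phi_swap)
qed

text \<open>By self-adjointness \<open>g((\<nabla>\<^sub>x\<phi>)Y,w)\<close> equals \<open>g(Y,(\<nabla>\<^sub>x\<phi>)W)\<close> for any extension \<open>W\<close> of \<open>w\<close>, and the
  latter involves \<open>Y\<close> only through its value at \<open>p\<close>.\<close>

lemma D_phi_tensorial:
  assumes x: "x \<in> T p" and Y: "vf p Y" and Z: "vf p Z" and eq: "Y p = Z p"
  shows "D_phi p x Y = D_phi p x Z"
proof -
  have "D_phi p x Y - D_phi p x Z = 0"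
  proof (rule pt.nondegenerate)
    show "D_phi p x Y - D_phi p x Z \<in> T p" by (intro pt.V_closed D_phi_in x Y Z)
    fix w assume "w \<in> T p"
    then obtain W where W: "vf p W" "W p = w" using extension by blast
    show "g p (D_phi p x Y - D_phi p x Z) w = 0"
      using D_phi_symmetric[OF x Y W(1)] D_phi_symmetric[OF x Z W(1)] eq W(2) \<open>w \<in> T p\<close>
        D_phi_in[OF x Y] D_phi_in[OF x Z] by (simp add: pt.g_simps)
  qed
  then show ?thesis by simp
qed

lemma D_phi_xi: "x \<in> T p \<Longrightarrow> D_phi p x \<xi> = - \<phi> p (D p x \<xi>)"
  unfolding cov_endo_def by (simp add: pt.phi_xi D_zero)

text \<open>The covariant derivative of the identity \<open>\<phi>\<^sup>2 = -I + \<eta> \<otimes> \<xi>\<close>.\<close>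

lemma D_phi_phi:
  assumes x: "x \<in> T p" and Y: "vf p Y"
  shows "D_phi p x (\<lambda>q. \<phi> q (Y q)) =
      - \<phi> p (D_phi p x Y) + cov_form D \<eta> p x Y *\<^sub>R \<xi> p + \<eta> p (Y p) *\<^sub>R D p x \<xi>"
proof -
  have "\<forall>\<^sub>F q in nhds p. \<phi> q (\<phi> q (Y q)) = \<eta> q (Y q) *\<^sub>R \<xi> q - Y q"
    using vector_field_near_eventually[OF Y] by eventually_elim (simp add: pt.phi_phi)
  from D_cong[OF x vf_phi[OF vf_phi[OF Y]] this]
  have "D p x (\<lambda>q. \<phi> q (\<phi> q (Y q))) =
      act x (\<lambda>q. \<eta> q (Y q)) *\<^sub>R \<xi> p + \<eta> p (Y p) *\<^sub>R D p x \<xi> - D p x Y"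
    using D_diff[OF x vf_eta_xi[OF Y] Y] D_eta_xi[OF x Y] by simp
  then show ?thesis
    unfolding cov_endo_def cov_form_def
    using D_in[OF x Y] D_in[OF x vf_phi[OF Y]]
    by (simp add: pt.phi_simps pt.V_closed pt.phi_phi algebra_simps)
qed

abbreviation F where "F \<equiv> F_tensor A \<phi> g D"

lemma F_eq:
  assumes x: "x \<in> T p" and Y: "vf p Y"
  shows "F p x (Y p) z = g p (D_phi p x Y) z"
proof -
  have "vf p (extend A p (Y p)) \<and> extend A p (Y p) p = Y p"
    unfolding extend_def by (rule someI[of _ Y]) (simp add: Y)
  then show ?thesis unfolding F_tensor_def using D_phi_tensorial[OF x _ Y] by simp
qed

lemma F_symmetric:
  assumes x: "x \<in> T p" and y: "y \<in> T p" and z: "z \<in> T p"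
  shows "F p x y z = F p x z y"
proof -
  obtain Y where Y: "vf p Y" "Y p = y" using extension[OF y] .
  obtain Z where Z: "vf p Z" "Z p = z" using extension[OF z] .
  show ?thesis
    using F_eq[OF x Y(1), of z] F_eq[OF x Z(1), of y] D_phi_symmetric[OF x Y(1) Z(1)]
      pt.g_sym[OF y D_phi_in[OF x Z(1)]] Y(2) Z(2) by simp
qed

text \<open>Linearity in the second argument comes from the third one by symmetry. The algebraic identity follows
  from \<open>D_phi_phi\<close>, paired with \<open>\<phi>z\<close>; the term with \<open>\<xi>\<close> disappears because \<open>\<phi>z\<close> is horizontal.\<close>

lemma F_like: "F_like (T p) (\<phi> p) (\<xi> p) (\<eta> p) (F p)"
proof -
  have linear_right: "linear_map_on (T p) (F p y z)" if y: "y \<in> T p" and z: "z \<in> T p" for y z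
  proof -
    obtain Z where Z: "vf p Z" "Z p = z" using extension[OF z] .
    then have "F p y z = g p (D_phi p y Z)" using F_eq[OF y Z(1)] by auto
    then show ?thesis using pt.g_linear[OF D_phi_in[OF y Z(1)]] by simp
  qed
  have linear_middle: "linear_map_on (T p) (\<lambda>x. F p y x z)" if y: "y \<in> T p" and z: "z \<in> T p" for y z
    using linear_right[OF y z] F_symmetric[OF y _ z] unfolding linear_map_on_def
    by (simp add: pt.V_closed)
  have linear_left: "linear_map_on (T p) (\<lambda>x. F p x y z)" if y: "y \<in> T p" and z: "z \<in> T p" for y z
  proof -
    obtain Y where Y: "vf p Y" "Y p = y" using extension[OF y] .
    have D_phi_lin: "D_phi p (a *\<^sub>R x + b *\<^sub>R x') Y = a *\<^sub>R D_phi p x Y + b *\<^sub>R D_phi p x' Y"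
      if "x \<in> T p" "x' \<in> T p" for x x' a b
      using D_linear[OF Y(1)] D_linear[OF vf_phi[OF Y(1)]] that D_in[OF _ Y(1)]
      unfolding cov_endo_def linear_map_on_def
      by (simp add: pt.phi_simps pt.V_closed algebra_simps)
    show ?thesis
      unfolding linear_map_on_def
      using F_eq[OF _ Y(1), of _ z] Y(2) D_phi_in[OF _ Y(1)] z
      by (simp add: pt.V_closed D_phi_lin pt.g_simps)
  qed
  have identity: "F p x y z = F p x (\<phi> p y) (\<phi> p z) + \<eta> p y * F p x (\<xi> p) z + \<eta> p z * F p x y (\<xi> p)"
    if x: "x \<in> T p" and y: "y \<in> T p" and z: "z \<in> T p" for x y z
  proof -
    obtain Y where Y: "vf p Y" "Y p = y" using extension[OF y] .
    note in_T = D_phi_in[OF x Y(1)] D_in[OF x vf_xi] z y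
    have "F p x (\<phi> p y) (\<phi> p z) = g p (D_phi p x (\<lambda>q. \<phi> q (Y q))) (\<phi> p z)"
      using F_eq[OF x vf_phi[OF Y(1)]] Y(2) by simp
    also have "\<dots> = - g p (\<phi> p (D_phi p x Y)) (\<phi> p z) + \<eta> p y * g p (\<phi> p (D p x \<xi>)) z"
      using in_T Y(2) D_phi_phi[OF x Y(1)]
      by (simp add: pt.g_simps pt.V_closed pt.g_xi_left pt.eta_phi pt.g_phi_swap)
    also have "\<dots> = F p x y z - \<eta> p z * F p x y (\<xi> p) - \<eta> p y * F p x (\<xi> p) z"
      using in_T Y(2) F_eq[OF x Y(1)] F_eq[OF x vf_xi] D_phi_xi[OF x]
      by (simp add: pt.g_phi pt.g_xi pt.g_simps pt.V_closed)
    finally show ?thesis by simp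
  qed
  show ?thesis
    unfolding F_like_def
    using linear_left linear_middle linear_right F_symmetric identity by blast
qed

section \<open>The Schouten-van Kampen connection\<close>

abbreviation D\<^sub>0 :: "'a connection" where "D\<^sub>0 \<equiv> schouten_van_kampen \<xi> \<eta> D"

lemma svk_eq:
  assumes x: "x \<in> T p" and Y: "vf p Y"
  shows "D\<^sub>0 p x Y = D p x Y - \<eta> p (Y p) *\<^sub>R D p x \<xi> + cov_form D \<eta> p x Y *\<^sub>R \<xi> p"
  unfolding schouten_van_kampen_def horiz_def vert_def
    D_diff[OF x Y vf_eta_xi[OF Y]] D_eta_xi[OF x Y] cov_form_def
  using D_in[OF x Y] D_in[OF x vf_xi]
  by (simp add: pt.eta_simps pt.V_closed pt.eta_xi eta_D_xi[OF x] algebra_simps)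

lemma vf_horiz: "vf p Y \<Longrightarrow> vf p (\<lambda>q. horiz \<xi> \<eta> q (Y q))"
  unfolding horiz_def by (intro vector_field_near_diff vf_eta_xi)

lemma vf_vert: "vf p Y \<Longrightarrow> vf p (\<lambda>q. vert \<xi> \<eta> q (Y q))"
  unfolding vert_def by (rule vf_eta_xi)

lemma svk_in:
  assumes "x \<in> T p" "vf p Y"
  shows "D\<^sub>0 p x Y \<in> T p"
  unfolding svk_eq[OF assms] by (intro pt.V_closed D_in assms vf_xi vector_field_near_tangent)

lemma svk_affine: "affine_connection A D\<^sub>0"
  unfolding affine_connection_def
proof (intro conjI allI ballI impI)
  fix p Y assume Y: "vf p Y"
  show "linear_map_on (T p) (\<lambda>x. D\<^sub>0 p x Y)"
    unfolding linear_map_on_def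
  proof (intro ballI allI)
    fix x y a b assume xy: "x \<in> T p" "y \<in> T p"
    then have "a *\<^sub>R x + b *\<^sub>R y \<in> T p" by (intro pt.V_closed)
    then show "D\<^sub>0 p (a *\<^sub>R x + b *\<^sub>R y) Y = a *\<^sub>R D\<^sub>0 p x Y + b *\<^sub>R D\<^sub>0 p y Y"
      using D_linear[OF Y] D_linear[OF vf_xi[of p]] xy D_in[OF xy(1) Y] D_in[OF xy(2) Y]
      unfolding linear_map_on_def
      by (simp add: svk_eq Y cov_form_def pt.eta_simps pt.V_closed algebra_simps)
  qed
next
  fix p Y x assume "vf p Y" "x \<in> T p"
  then show "D\<^sub>0 p x Y \<in> T p" using svk_in by blast
next
  fix p Y Z x assume x: "x \<in> T p" and Y: "vf p Y" and Z: "vf p Z"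
  have "\<forall>\<^sub>F q in nhds p. \<eta> q (Y q + Z q) = \<eta> q (Y q) + \<eta> q (Z q)"
    using vector_field_near_eventually[OF Y] vector_field_near_eventually[OF Z]
    by eventually_elim (rule pt.eta_simps)
  from act_cong[OF x this]
  have "act x (\<lambda>q. \<eta> q (Y q + Z q)) = act x (\<lambda>q. \<eta> q (Y q)) + act x (\<lambda>q. \<eta> q (Z q))"
    using tangent_add[OF x smooth_eta[OF Y] smooth_eta[OF Z]] by simp
  then show "D\<^sub>0 p x (\<lambda>q. Y q + Z q) = D\<^sub>0 p x Y + D\<^sub>0 p x Z"
    using D_in[OF x Y] D_in[OF x Z] vector_field_near_tangent[OF Y] vector_field_near_tangent[OF Z]
    by (simp add: svk_eq x Y Z vector_field_near_add D_add cov_form_def pt.eta_simps algebra_simps)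
next
  fix p f Y x assume x: "x \<in> T p" and f: "smooth_near A p f" and Y: "vf p Y"
  have "\<forall>\<^sub>F q in nhds p. \<eta> q (f q *\<^sub>R Y q) = f q * \<eta> q (Y q)"
    using vector_field_near_eventually[OF Y] by eventually_elim (simp add: pt.eta_simps)
  from act_cong[OF x this]
  have "act x (\<lambda>q. \<eta> q (f q *\<^sub>R Y q)) = act x f * \<eta> p (Y p) + f p * act x (\<lambda>q. \<eta> q (Y q))"
    using tangent_mult[OF x f smooth_eta[OF Y]] by simp
  then show "D\<^sub>0 p x (\<lambda>q. f q *\<^sub>R Y q) = act x f *\<^sub>R Y p + f p *\<^sub>R D\<^sub>0 p x Y"
    using D_in[OF x Y] vector_field_near_tangent[OF Y]
    by (simp add: svk_eq x f Y vector_field_near_scale D_scale cov_form_def pt.eta_simps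
        pt.V_closed algebra_simps)
next
  fix p X Y assume X: "vf p X" and Y: "vf p Y"
  show "vf p (\<lambda>q. D\<^sub>0 q (X q) Y)"
    unfolding schouten_van_kampen_def
    by (intro vector_field_near_add vf_horiz vf_vert D_smooth X Y)
qed

lemma svk_eta:
  assumes x: "x \<in> T p" and Y: "vf p Y"
  shows "cov_form D\<^sub>0 \<eta> p x Y = 0"
  using D_in[OF x Y] D_in[OF x vf_xi] svk_eq[OF x Y]
  by (simp add: cov_form_def pt.eta_simps pt.V_closed pt.eta_xi eta_D_xi[OF x])

lemma svk_xi:
  assumes x: "x \<in> T p"
  shows "D\<^sub>0 p x \<xi> = 0"
  using tangent_const[OF x, of 1] by (simp add: svk_eq x vf_xi pt.eta_xi cov_form_def eta_D_xi[OF x])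

text \<open>The two correction terms in \<open>svk_eq\<close> are adjoint to each other up to sign, since
  \<open>(\<nabla>\<^sub>x\<eta>)(y) = g(y,\<nabla>\<^sub>x\<xi>)\<close>.\<close>

lemma svk_metric: "metric_parallel A g D\<^sub>0"
  unfolding metric_parallel_def
proof (intro allI ballI impI)
  fix p Y Z x assume x: "x \<in> T p" and Y: "vf p Y" and Z: "vf p Z"
  note in_T = D_in[OF x Y] D_in[OF x Z] D_in[OF x vf_xi]
    vector_field_near_tangent[OF Y] vector_field_near_tangent[OF Z]
  show "cov_metric D\<^sub>0 g p x Y Z = 0"
    using in_T pt.g_sym[OF in_T(3) in_T(5)]
    by (simp add: cov_metric_def D_metric[OF x Y Z] x Y Z svk_eq cov_form_eq pt.g_simps pt.V_closed pt.g_xi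
        pt.g_xi_left)
qed

text \<open>The field \<open>\<phi>Y\<close> is horizontal, so \<open>\<nabla>\<^sup>0\<^sub>x(\<phi>Y)\<close> is the horizontal part of \<open>\<nabla>\<^sub>x(\<phi>Y)\<close>, while
  \<open>\<phi>(\<nabla>\<^sup>0\<^sub>xY) = \<phi>(\<nabla>\<^sub>xY) - \<eta>(Y) \<phi>(\<nabla>\<^sub>x\<xi>)\<close> and \<open>\<phi>(\<nabla>\<^sub>x\<xi>) = -(\<nabla>\<^sub>x\<phi>)\<xi>\<close>.\<close>

lemma svk_phi:
  assumes x: "x \<in> T p" and Y: "vf p Y"
  shows "cov_endo D\<^sub>0 \<phi> p x Y = D_phi p x Y - \<eta> p (D_phi p x Y) *\<^sub>R \<xi> p - \<eta> p (Y p) *\<^sub>R D_phi p x \<xi>"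
proof -
  note in_T = D_in[OF x Y] D_in[OF x vf_phi[OF Y]] D_in[OF x vf_xi] vector_field_near_tangent[OF Y]
  have "\<forall>\<^sub>F q in nhds p. \<eta> q (\<phi> q (Y q)) = 0"
    using vector_field_near_eventually[OF Y] by eventually_elim (rule pt.eta_phi)
  from act_cong[OF x this] have "cov_form D \<eta> p x (\<lambda>q. \<phi> q (Y q)) = - \<eta> p (D_phi p x Y)"
    using in_T tangent_const[OF x] by (simp add: cov_form_def cov_endo_def pt.eta_simps pt.V_closed pt.eta_phi)
  then show ?thesis
    using in_T unfolding cov_endo_def[of D\<^sub>0] D_phi_xi[OF x]
    by (simp add: svk_eq x Y vf_phi pt.eta_phi pt.phi_simps pt.V_closed pt.phi_xi)
       (simp add: cov_endo_def)
qed

lemma svk_natural_iff: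
  "natural_connection A \<phi> \<xi> \<eta> g D\<^sub>0 \<longleftrightarrow>
     (\<forall>p Y. \<forall>x\<in>T p. vf p Y \<longrightarrow> cov_endo D\<^sub>0 \<phi> p x Y = 0)"
  unfolding natural_connection_def using svk_affine svk_eta svk_xi svk_metric by blast

lemma svk_phi_metric:
  assumes x: "x \<in> T p" and Y: "vf p Y" and z: "z \<in> T p"
  shows "g p (cov_endo D\<^sub>0 \<phi> p x Y) z =
      F p x (Y p) z - F p x (Y p) (\<xi> p) * \<eta> p z - F p x z (\<xi> p) * \<eta> p (Y p)"
  unfolding svk_phi[OF x Y]
  using D_phi_in[OF x Y] D_phi_in[OF x vf_xi] z F_eq[OF x Y] F_eq[OF x vf_xi] F_symmetric[OF x z pt.xi_in]
  by (simp add: pt.g_simps pt.V_closed pt.g_xi_left pt.g_xi)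

lemma svk_phi_parallel_iff:
  "(\<forall>x\<in>T p. \<forall>Y. vf p Y \<longrightarrow> cov_endo D\<^sub>0 \<phi> p x Y = 0) \<longleftrightarrow> F6_9_form (T p) (\<xi> p) (\<eta> p) (F p)"
proof
  assume parallel: "\<forall>x\<in>T p. \<forall>Y. vf p Y \<longrightarrow> cov_endo D\<^sub>0 \<phi> p x Y = 0"
  show "F6_9_form (T p) (\<xi> p) (\<eta> p) (F p)"
    unfolding F6_9_form_def
  proof (intro ballI)
    fix x y z assume x: "x \<in> T p" and y: "y \<in> T p" and z: "z \<in> T p"
    obtain Y where Y: "vf p Y" "Y p = y" using extension[OF y] .
    have "g p 0 z = 0" using pt.g_simps(10)[OF z] .
    then show "F p x y z = F p x y (\<xi> p) * \<eta> p z + F p x z (\<xi> p) * \<eta> p y"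
      using parallel x Y svk_phi_metric[OF x Y(1) z] by simp
  qed
next
  assume form: "F6_9_form (T p) (\<xi> p) (\<eta> p) (F p)"
  show "\<forall>x\<in>T p. \<forall>Y. vf p Y \<longrightarrow> cov_endo D\<^sub>0 \<phi> p x Y = 0"
  proof (intro ballI allI impI)
    fix x Y assume x: "x \<in> T p" and Y: "vf p Y"
    show "cov_endo D\<^sub>0 \<phi> p x Y = 0"
    proof (rule pt.nondegenerate)
      show "cov_endo D\<^sub>0 \<phi> p x Y \<in> T p"
        unfolding cov_endo_def by (intro pt.V_closed svk_in x vf_phi Y)
      fix z assume z: "z \<in> T p"
      have "F p x (Y p) z = F p x (Y p) (\<xi> p) * \<eta> p z + F p x z (\<xi> p) * \<eta> p (Y p)"
        using form x vector_field_near_tangent[OF Y] z unfolding F6_9_form_def by blast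
      then show "g p (cov_endo D\<^sub>0 \<phi> p x Y) z = 0"
        using svk_phi_metric[OF x Y z] by simp
    qed
  qed
qed

lemma svk_natural_iff_U2:
  "natural_connection A \<phi> \<xi> \<eta> g D\<^sub>0 \<longleftrightarrow> belongs_to_U2 A n \<phi> \<xi> \<eta> g D"
proof -
  have "natural_connection A \<phi> \<xi> \<eta> g D\<^sub>0 \<longleftrightarrow> (\<forall>p. F6_9_form (T p) (\<xi> p) (\<eta> p) (F p))"
    unfolding svk_natural_iff svk_phi_parallel_iff[symmetric] by blast
  also have "\<dots> \<longleftrightarrow> belongs_to_U2 A n \<phi> \<xi> \<eta> g D"
    unfolding belongs_to_U2_def
    using pt.form_imp_U2_class[OF F_like] pt.U2_class_imp_form by blast
  finally show ?thesis .
qed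

text \<open>Apply parallelism of \<open>\<phi>\<close> to the field \<open>\<phi>Y\<close>: it makes \<open>(\<nabla>\<^sub>x\<phi>)\<phi>Y\<close> vertical, and its vertical
  component is known from \<open>D_phi_phi\<close>.\<close>

lemma svk_eq_phiB:
  assumes natural: "natural_connection A \<phi> \<xi> \<eta> g D\<^sub>0" and x: "x \<in> T p" and Y: "vf p Y"
  shows "D\<^sub>0 p x Y = phiB_connection \<phi> \<xi> \<eta> D p x Y"
proof -
  let ?phiY = "\<lambda>q. \<phi> q (Y q)"
  have "\<eta> p (D_phi p x ?phiY) = cov_form D \<eta> p x Y"
    using D_phi_phi[OF x Y] D_phi_in[OF x Y] D_in[OF x vf_xi]
    by (simp add: pt.eta_simps pt.V_closed pt.eta_phi pt.eta_xi eta_D_xi[OF x])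
  moreover have "cov_endo D\<^sub>0 \<phi> p x ?phiY = 0"
    using natural x vf_phi[OF Y] unfolding svk_natural_iff by blast
  ultimately have "D_phi p x ?phiY = cov_form D \<eta> p x Y *\<^sub>R \<xi> p"
    using svk_phi[OF x vf_phi[OF Y]] pt.eta_phi[OF vector_field_near_tangent[OF Y]] by simp
  then show ?thesis
    unfolding phiB_connection_def svk_eq[OF x Y] by (simp add: scaleR_2[symmetric])
qed

end

theorem theorem7p3:
  fixes A :: "('a::{t2_space,second_countable_topology}, 'e::euclidean_space) atlas"
    and n :: nat
    and \<phi> :: "'a \<Rightarrow> 'a functional \<Rightarrow> 'a functional"
    and \<xi> :: "'a \<Rightarrow> 'a functional"
    and \<eta> :: "'a \<Rightarrow> 'a functional \<Rightarrow> real"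
    and g :: "'a \<Rightarrow> 'a functional \<Rightarrow> 'a functional \<Rightarrow> real"
    and D :: "'a connection"
  assumes "almost_contact_B_metric_manifold A n \<phi> \<xi> \<eta> g"
    and "levi_civita A g D"
  shows "(natural_connection A \<phi> \<xi> \<eta> g (schouten_van_kampen \<xi> \<eta> D) \<longleftrightarrow>
            belongs_to_U2 A n \<phi> \<xi> \<eta> g D) \<and>
         (belongs_to_U2 A n \<phi> \<xi> \<eta> g D \<longrightarrow>
            (\<forall>p Y. \<forall>x\<in>tangent_space A p. vector_field_near A p Y \<longrightarrow>
               schouten_van_kampen \<xi> \<eta> D p x Y = phiB_connection \<phi> \<xi> \<eta> D p x Y))"
proof -
  interpret almost_contact_B_metric_manifold_connection A n \<phi> \<xi> \<eta> g D
    using assms unfolding levi_civita_def by unfold_locales blast+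
  show ?thesis using svk_natural_iff_U2 svk_eq_phiB by blast
qed

end
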